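(* Let $S\in\mathbb{S}^d_m$, let $Y\in\mathcal{L}_2(\mathbb{R}^d)$ and suppose that $\nu:=\mathrm{Law}(Y)$ is atomless. Then $$\sup_{X\in\mathcal{X}(Y)}\mathbb{E}[S(X,Y)]=\max_{\gamma\in\Gamma(\nu)}\int S(x,y)\,d\gamma .$$
   Context: $\mathbb{S}^d_m$ denotes the set of symmetric invertible $d\times d$ real matrices with exactly $m\in\{0,1,\dots,d\}$ positive eigenvalues; for such $S$ write $S(x,y):=\langle x,Sy\rangle$, $x,y\in\mathbb{R}^d$. Random variables live on a probability space $(\Omega,\mathcal{F},\mathbb{P})$, relations between them hold a.s., and $\mathcal{L}_2(\mathbb{R}^d)$ is the set of $d$-dimensional random variables with finite second moment. For $Y\in\mathcal{L}_2(\mathbb{R}^d)$, $\mathcal{X}(Y):=\{X\in\mathcal{L}_2(\mathbb{R}^d): X \text{ is } Y\text{-measurable and } \mathbb{E}[Y\mid X]=X\}$. For a Borel probability measure $\nu$ on $\mathbb{R}^d$ with finite second moment, $\Gamma(\nu)$ is the set of Borel probability measures $\gamma$ on $\mathbb{R}^d\times\mathbb{R}^d$ (coordinates $(x,y)$) with finite second moments, whose second marginal is $\nu$, and such that the $\gamma$-conditional expectation of $y$ given $x$ equals $x$. (The maximum on the right-hand side is attained.) *)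

theory Defs
  imports "HOL-Analysis.Analysis" "HOL-Probability.Probability"
begin

text \<open>The set S^d_m: symmetric invertible d x d real matrices with exactly m positive
  eigenvalues (counted with multiplicity, i.e. m positive diagonal entries in a spectral
  decomposition S = U D U^T with U orthogonal and D diagonal). Here d = CARD('n).\<close>
definition sym_inv_pos :: "nat \<Rightarrow> (real^'n^'n) set" where
  "sym_inv_pos m = {S. transpose S = S \<and> invertible S \<and>
     (\<exists>U D::real^'n^'n. orthogonal_matrix U \<and> (\<forall>i j. i \<noteq> j \<longrightarrow> D $ i $ j = 0) \<and>
        S = U ** D ** transpose U \<and> card {i. D $ i $ i > 0} = m)}"

definition bform :: "real^'n^'n \<Rightarrow> real^'n \<Rightarrow> real^'n \<Rightarrow> real" where
  "bform S x y = x \<bullet> (S *v y)"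

definition L2rv :: "'a measure \<Rightarrow> ('a \<Rightarrow> real^'n) \<Rightarrow> bool" where
  "L2rv M Y \<longleftrightarrow> Y \<in> borel_measurable M \<and> integrable M (\<lambda>\<omega>. (norm (Y \<omega>))\<^sup>2)"

definition Xset :: "'a measure \<Rightarrow> ('a \<Rightarrow> real^'n) \<Rightarrow> ('a \<Rightarrow> real^'n) set" where
  "Xset M Y = {X. L2rv M X \<and> X \<in> measurable (vimage_algebra (space M) Y borel) borel \<and>
     (\<forall>i. AE \<omega> in M. real_cond_exp M (vimage_algebra (space M) X borel) (\<lambda>\<omega>. Y \<omega> $ i) \<omega>
                      = X \<omega> $ i)}"

definition MGamma :: "(real^'n) measure \<Rightarrow> ((real^'n) \<times> (real^'n)) measure set" where
  "MGamma \<nu> = {\<gamma>. prob_space \<gamma> \<and> sets \<gamma> = sets borel \<and>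
     integrable \<gamma> (\<lambda>p. (norm (fst p))\<^sup>2) \<and> integrable \<gamma> (\<lambda>p. (norm (snd p))\<^sup>2) \<and>
     distr \<gamma> borel snd = \<nu> \<and>
     (\<forall>i. AE p in \<gamma>. real_cond_exp \<gamma> (vimage_algebra (space \<gamma>) fst borel) (\<lambda>p. snd p $ i) p
                      = fst p $ i)}"

definition atomless :: "'b measure \<Rightarrow> bool" where
  "atomless \<nu> \<longleftrightarrow> (\<forall>x. emeasure \<nu> {x} = 0)"

end

theory Submission
  imports Defs
begin

text \<open>
  For \<open>X \<in> \<X>(Y)\<close> the law of \<open>(X, Y)\<close> lies in \<open>\<Gamma>(\<nu>)\<close>, so the supremum is at most the maximum.

  The maximum is attained by compactness. A Borel injection of Euclidean space into \<open>[0, 1]\<close> with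
  Borel left inverse reduces the extraction of a limit to Helly's and Skorohod's theorems on the
  line: along a subsequence, the elements of a maximizing sequence are the laws of pairs
  \<open>(X\<^sub>n, Y\<^sub>n)\<close> converging almost everywhere. As \<open>X\<^sub>n\<close> is bounded in \<open>L\<^sup>2\<close> and all \<open>Y\<^sub>n\<close> have
  law \<open>\<nu>\<close>, both the martingale property and the value pass to the limit.

  Conversely, let \<open>\<gamma> \<in> \<Gamma>(\<nu>)\<close> and \<open>\<delta> > 0\<close>, and split the space into countably many cells of
  diameter of order \<open>\<delta>\<close>. Since \<open>\<nu>\<close> is atomless, there is a Borel map \<open>\<theta>\<close> such that \<open>\<theta>(Y)\<close> and the
  cell of \<open>Y\<close> have the joint law of \<open>x\<close> and the cell of \<open>y\<close> under \<open>\<gamma>\<close>. Then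
  \<open>X = E[Y | \<theta>(Y)]\<close> lies in \<open>\<X>(Y)\<close>, it is within \<open>O(\<delta>)\<close> of \<open>\<theta>(Y)\<close>, and its value is within
  \<open>O(\<delta>)\<close> of that of \<open>\<gamma>\<close>.
\<close>

section \<open>Coding Euclidean space by real numbers\<close>

text \<open>Two obstacles shape the proof. As X must be a function of Y, the law of (\<theta>(Y), Y)
  is carried by a graph and in general cannot equal \<gamma>. Hence only the cell of y is matched;
  inside a cell, atomlessness of \<nu> leaves enough freedom to realise the conditional law of x.
  This matching destroys the martingale property, but only slightly: on every event \<theta>(Y)
  \<in> B the integrals of Y and of \<theta>(Y) differ in each coordinate by at most 2 \<delta>
  times its probability. So E[Y | \<theta>(Y)] is uniformly close to \<theta>(Y); it restores the
  martingale property and is still a function of Y.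

  For compactness, bounded second moments alone do not make the products of coordinates of x and y
  uniformly integrable; the fixed second marginal does. Moreover the coding is discontinuous, so
  convergence of codes does not by itself give convergence of points. Digits that are stable under
  small perturbations turn it into eventual constancy of ball memberships, and Fatou's lemma
  excludes escape to infinity.\<close>

definition ternary_code :: "(nat \<Rightarrow> bool) \<Rightarrow> real" where
  "ternary_code a = (\<Sum>n. of_bool (a n) * (1/3) ^ Suc n)"

lemma summable_ternary_code: "summable (\<lambda>n. of_bool (a n) * (1/3::real) ^ Suc n)"
proof (rule summable_comparison_test')
  show "summable (\<lambda>n. (1/3::real) ^ Suc n)"
    by (simp only: summable_Suc_iff) (simp add: summable_geometric)
qed (auto simp: of_bool_def)

lemma ternary_code_bounds: "0 \<le> ternary_code a" "ternary_code a \<le> 1/2"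
proof -
  show "0 \<le> ternary_code a"
    unfolding ternary_code_def by (intro suminf_nonneg summable_ternary_code) auto
  have s: "(\<lambda>n. (1/3::real) ^ Suc n) sums (1/2)"
    using sums_mult[OF geometric_sums[of "1/3::real"], of "1/3"] by simp
  have "ternary_code a \<le> (\<Sum>n. (1/3::real) ^ Suc n)"
    unfolding ternary_code_def
    by (intro suminf_le summable_ternary_code sums_summable[OF s]) auto
  with s show "ternary_code a \<le> 1/2" by (simp only: sums_iff)
qed

lemma ternary_code_shift:
  "3 * ternary_code a = of_bool (a 0) + ternary_code (\<lambda>n. a (Suc n))"
proof -
  have "ternary_code a = (\<Sum>n. of_bool (a (Suc n)) * (1/3) ^ Suc (Suc n)) + of_bool (a 0) * (1/3)"
    using suminf_split_head[OF summable_ternary_code[of a]] unfolding ternary_code_def by simp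
  also have "(\<Sum>n. of_bool (a (Suc n)) * (1/3::real) ^ Suc (Suc n))
      = (1/3) * ternary_code (\<lambda>n. a (Suc n))"
    unfolding ternary_code_def suminf_mult[OF summable_ternary_code, symmetric]
    by (intro suminf_cong) simp
  finally show ?thesis by simp
qed

text \<open>All digits after the first contribute at most 1/6, so the two possible leading digits
  are separated by the gap between 1/6 and 1/3. Digits 0 and 1 in base 2 would leave no gap.\<close>

lemma ternary_code_digit_bounds:
  "a 0 \<Longrightarrow> 1/3 \<le> ternary_code a" "\<not> a 0 \<Longrightarrow> ternary_code a \<le> 1/6"
  using ternary_code_shift[of a] ternary_code_bounds[of "\<lambda>n. a (Suc n)"] by auto

lemma ternary_code_power:
  "\<exists>k::int. 3 ^ n * ternary_code a = of_int k + ternary_code (\<lambda>i. a (n + i))"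
proof (induction n)
  case 0
  show ?case by (intro exI[of _ 0]) simp
next
  case (Suc n)
  then obtain k :: int where "3 ^ n * ternary_code a = of_int k + ternary_code (\<lambda>i. a (n + i))" by blast
  then have "3 ^ Suc n * ternary_code a = of_int (3 * k) + 3 * ternary_code (\<lambda>i. a (n + i))"
    by simp
  also have "\<dots> = of_int (3 * k + of_bool (a n)) + ternary_code (\<lambda>i. a (Suc n + i))"
    using ternary_code_shift[of "\<lambda>i. a (n + i)"] by simp
  finally show ?case by blast
qed

text \<open>Multiplication by \<open>3 ^ n\<close> moves the first n digits into the integer part,
  and the rest is at most 1/2, hence is the fractional part. The criterion is Borel in the code and
  makes sense for every real number, which allows a decoding map on the whole line.\<close>

lemma ternary_code_digit: "a n \<longleftrightarrow> 1/3 \<le> frac (3 ^ n * ternary_code a)"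
proof -
  obtain k :: int where k: "3 ^ n * ternary_code a = of_int k + ternary_code (\<lambda>i. a (n + i))"
    using ternary_code_power by blast
  have "frac (3 ^ n * ternary_code a) = ternary_code (\<lambda>i. a (n + i))"
    unfolding k using ternary_code_bounds[of "\<lambda>i. a (n + i)"] by (subst frac_unique_iff) auto
  then show ?thesis
    using ternary_code_digit_bounds[of "\<lambda>i. a (n + i)"] by fastforce
qed

text \<open>The gap separating the two values of a digit has width 1/6; scaling it back by
  \<open>3 ^ n\<close> gives the tolerance. This replaces continuity of the decoding map.\<close>

lemma ternary_code_digit_stable:
  assumes "\<bar>ternary_code a - ternary_code b\<bar> < 1 / (6 * 3 ^ n)"
  shows "a n \<longleftrightarrow> b n"
proof -
  let ?a = "ternary_code (\<lambda>i. a (n + i))" and ?b = "ternary_code (\<lambda>i. b (n + i))"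
  obtain k l :: int where k: "3 ^ n * ternary_code a = of_int k + ?a"
    and l: "3 ^ n * ternary_code b = of_int l + ?b"
    using ternary_code_power by metis
  have "\<bar>3 ^ n * ternary_code a - 3 ^ n * ternary_code b\<bar> = 3 ^ n * \<bar>ternary_code a - ternary_code b\<bar>"
    by (simp add: abs_mult flip: right_diff_distrib)
  also have "\<dots> < 3 ^ n * (1 / (6 * 3 ^ n))"
    using assms by (intro mult_strict_left_mono) auto
  finally have d: "\<bar>(of_int k + ?a) - (of_int l + ?b)\<bar> < 1/6"
    using k l by simp
  note bd = ternary_code_bounds[of "\<lambda>i. a (n + i)"] ternary_code_bounds[of "\<lambda>i. b (n + i)"]
  \<comment> \<open>Both tails lie between 0 and 1/2, so the integer parts differ by less than 1/6 +
    1/2.\<close>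
  have "\<bar>real_of_int (k - l)\<bar> < 1" using d bd unfolding of_int_diff by linarith
  then have "k = l" by linarith
  then have "\<bar>?a - ?b\<bar> < 1/6" using d by simp
  then show ?thesis
    using ternary_code_digit_bounds[of "\<lambda>i. a (n + i)"] ternary_code_digit_bounds[of "\<lambda>i. b (n + i)"]
    by fastforce
qed

section \<open>Codes of points by membership in balls\<close>

lemma dense_sequence:
  obtains q :: "nat \<Rightarrow> 'a::{metric_space, second_countable_topology}"
  where "\<And>v e. e > 0 \<Longrightarrow> \<exists>i. dist (q i) v < e"
proof -
  obtain D :: "'a set" where D: "countable D" "\<And>X. open X \<Longrightarrow> X \<noteq> {} \<Longrightarrow> \<exists>d\<in>D. d \<in> X"
    by (rule countable_dense_setE) blast
  show thesis
  proof
    fix v :: 'a and e :: real assume "e > 0"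
    then obtain d where "d \<in> D" "d \<in> ball v e" using D(2)[of "ball v e"] by auto
    then show "\<exists>i. dist (from_nat_into D i) v < e"
      using from_nat_into_surj[OF D(1)] by (metis dist_commute mem_ball)
  qed
qed

text \<open>The code of a point records which of countably many basic balls contain it. When codes
  converge, each of these memberships is eventually constant, so a sequence of points whose codes
  converge has at most one cluster point; this is the last clause.\<close>

lemma borel_coding:
  obtains T :: "'a::euclidean_space \<Rightarrow> real" and g :: "real \<Rightarrow> 'a"
  where "T \<in> borel_measurable borel" "g \<in> borel_measurable borel"
    "\<And>v. g (T v) = v" "\<And>v. 0 \<le> T v" "\<And>v. T v \<le> 1"
    "\<And>z B. convergent (\<lambda>n. T (z n)) \<Longrightarrow> \<forall>N. \<exists>n\<ge>N. norm (z n) \<le> B \<Longrightarrow> convergent z"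
proof -
  obtain q :: "nat \<Rightarrow> 'a" where q: "\<And>v e. e > 0 \<Longrightarrow> \<exists>i. dist (q i) v < e"
    by (rule dense_sequence) blast
  define A where "A n v \<longleftrightarrow> dist (q (fst (prod_decode n))) v < 1 / real (Suc (snd (prod_decode n)))" for n v
  have [measurable]: "Measurable.pred borel (A n)" for n unfolding A_def by measurable
  define T where "T v = ternary_code (\<lambda>n. A n v)" for v
  \<comment> \<open>For each k, the digits of a code reveal the first centre within 1/(k+1) of the
    coded point; these centres converge to it. At reals that are not codes only measurability
    matters.\<close>
  define g where "g t = lim (\<lambda>k. q (LEAST i. 1/3 \<le> frac (3 ^ prod_encode (i, k) * t)))" for t :: real
  have T: "T \<in> borel_measurable borel"
    unfolding T_def ternary_code_def of_bool_def by measurable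
  have fr: "(\<lambda>x::real. frac x) \<in> borel_measurable borel" unfolding frac_def by measurable
  have g: "g \<in> borel_measurable borel"
    unfolding g_def
  proof (intro borel_measurable_lim_metric)
    fix k
    have "(\<lambda>t::real. LEAST i. 1/3 \<le> frac (3 ^ prod_encode (i, k) * t)) \<in> borel \<rightarrow>\<^sub>M count_space UNIV"
      using fr by measurable
    then show "(\<lambda>t::real. q (LEAST i. 1/3 \<le> frac (3 ^ prod_encode (i, k) * t))) \<in> borel_measurable borel"
      by measurable
  qed
  have gT: "g (T v) = v" for v
  proof -
    have *: "dist (q (LEAST i. 1/3 \<le> frac (3 ^ prod_encode (i, k) * T v))) v < 1 / real (Suc k)" for k
    proof -
      have "\<exists>i. A (prod_encode (i, k)) v" using q[of "1 / real (Suc k)" v] by (auto simp: A_def)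
      then have "A (prod_encode (LEAST i. A (prod_encode (i, k)) v, k)) v" by (rule LeastI_ex)
      then show ?thesis
        unfolding T_def ternary_code_digit[of "\<lambda>n. A n v", symmetric] by (simp add: A_def)
    qed
    have "(\<lambda>k. q (LEAST i. 1/3 \<le> frac (3 ^ prod_encode (i, k) * T v))) \<longlonglongrightarrow> v"
    proof (rule tendsto_dist_iff[THEN iffD2], rule tendsto_sandwich[OF _ _ tendsto_const])
      show "(\<lambda>k. 1 / real (Suc k)) \<longlonglongrightarrow> 0"
        using LIMSEQ_Suc[OF lim_1_over_n] by simp
    qed (use * in \<open>auto intro!: always_eventually less_imp_le simp del: of_nat_Suc\<close>)
    then show ?thesis unfolding g_def by (rule limI)
  qed
  have conv: "convergent z" if c: "convergent (\<lambda>n. T (z n))"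
    and io: "\<forall>N. \<exists>n\<ge>N. norm (z n) \<le> B" for z :: "nat \<Rightarrow> 'a" and B
  proof -
    have ev: "\<exists>N. \<forall>m\<ge>N. \<forall>n\<ge>N. A j (z m) \<longleftrightarrow> A j (z n)" for j
    proof -
      have "Cauchy (\<lambda>n. T (z n))" using c by (rule convergent_Cauchy)
      then obtain N where "\<forall>m\<ge>N. \<forall>n\<ge>N. norm (T (z m) - T (z n)) < 1 / (6 * 3 ^ j)"
        using CauchyD[of _ "1 / (6 * 3 ^ j)"] by (metis divide_pos_pos mult_pos_pos zero_less_numeral zero_less_one zero_less_power)
      then show ?thesis
        unfolding T_def real_norm_def by (blast dest: ternary_code_digit_stable)
    qed
    have "infinite {n. norm (z n) \<le> B}"
      unfolding infinite_nat_iff_unbounded_le using io by simp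
    then obtain r :: "nat \<Rightarrow> nat" where r: "strict_mono r" "\<And>n. r n \<in> {n. norm (z n) \<le> B}"
      using infinite_enumerate by blast
    have "seq_compact (cball (0::'a) B)" using compact_cball compact_eq_seq_compact_metric by blast
    then obtain y r' where y: "strict_mono r'" "((\<lambda>n. z (r n)) \<circ> r') \<longlonglongrightarrow> y"
      using r(2) unfolding seq_compact_def by (metis (no_types, lifting) mem_Collect_eq mem_cball_0)
    have rr: "strict_mono (r \<circ> r')" using r(1) y(1) by (rule strict_mono_o)
    \<comment> \<open>A small ball about some \<open>q i\<close> contains the cluster point y. It is
      open, so the subsequence enters it; as membership is eventually constant, the whole sequence
      does.\<close>
    have "z \<longlonglongrightarrow> y"
    proof (rule metric_LIMSEQ_I)
      fix e :: real assume "e > 0"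
      obtain k where k: "1 / real (Suc k) < e / 2" using \<open>e > 0\<close> nat_approx_posE[of "e/2"] by auto
      obtain i where i: "dist (q i) y < 1 / real (Suc k)" using q[of "1 / real (Suc k)" y] by auto
      let ?j = "prod_encode (i, k)"
      have A: "A ?j v \<longleftrightarrow> dist (q i) v < 1 / real (Suc k)" for v by (simp add: A_def)
      obtain N where N: "\<And>m n. m \<ge> N \<Longrightarrow> n \<ge> N \<Longrightarrow> A ?j (z m) \<longleftrightarrow> A ?j (z n)" using ev by blast
      have "\<forall>\<^sub>F n in sequentially. dist (q i) (((\<lambda>n. z (r n)) \<circ> r') n) < 1 / real (Suc k)"
        by (rule order_tendstoD(2)[OF tendsto_dist[OF tendsto_const y(2)] i])
      then obtain N' where N': "\<And>n. n \<ge> N' \<Longrightarrow> A ?j (z (r (r' n)))"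
        unfolding eventually_sequentially A by auto
      let ?m = "max N N'"
      have "r (r' ?m) \<ge> N" using seq_suble[OF rr, of ?m] by simp
      then have in_A: "A ?j (z n)" if "n \<ge> N" for n using N[OF that] N'[of ?m] by auto
      show "\<exists>no. \<forall>n\<ge>no. dist (z n) y < e"
      proof (intro exI allI impI)
        fix n assume "n \<ge> N"
        then have "dist (q i) (z n) < e/2" using in_A k unfolding A by fastforce
        moreover have "dist (q i) y < e/2" using i k by simp
        ultimately show "dist (z n) y < e" by (metis dist_commute dist_triangle_half_l)
      qed
    qed
    then show ?thesis by (rule convergentI)
  qed
  show thesis
  proof (rule that[OF T g gT _ _ conv])
    show "0 \<le> T v" "T v \<le> 1" for v
      using ternary_code_bounds[of "\<lambda>n. A n v"] by (auto simp: T_def)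
  qed
qed

text \<open>The codes take values in [0, 1], so their laws are tight at no cost, and Skorohod's
  theorem yields convergent codes. The moment bound enters only afterwards, to make the decoded
  points return to a bounded set infinitely often.\<close>

lemma subsequence_converging_AE:
  fixes P :: "nat \<Rightarrow> 'a::euclidean_space measure"
  assumes prob: "\<And>n. prob_space (P n)" and sets: "\<And>n. sets (P n) = sets borel"
    and bound: "\<And>n. (\<integral>\<^sup>+ z. ennreal ((norm z)\<^sup>2) \<partial>P n) \<le> ennreal C"
  obtains \<Omega> :: "real measure" and r :: "nat \<Rightarrow> nat" and Z Z'
  where "strict_mono r" "prob_space \<Omega>" "\<And>n. Z n \<in> borel_measurable \<Omega>" "Z' \<in> borel_measurable \<Omega>"
    "\<And>n. distr \<Omega> borel (Z n) = P (r n)" "AE \<omega> in \<Omega>. (\<lambda>n. Z n \<omega>) \<longlonglongrightarrow> Z' \<omega>"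
proof -
  obtain T :: "'a \<Rightarrow> real" and g :: "real \<Rightarrow> 'a" where
    T[measurable]: "T \<in> borel_measurable borel" and g[measurable]: "g \<in> borel_measurable borel"
    and gT: "\<And>v. g (T v) = v" and T0: "\<And>v. 0 \<le> T v" and T1: "\<And>v. T v \<le> 1"
    and conv: "\<And>z B. convergent (\<lambda>n. T (z n)) \<Longrightarrow> \<forall>N. \<exists>n\<ge>N. norm (z n) \<le> B \<Longrightarrow> convergent z"
    by (rule borel_coding) blast
  note [measurable_cong] = sets
  define Q where "Q n = distr (P n) borel T" for n
  have Q: "real_distribution (Q n)" for n
    unfolding Q_def by (intro prob_space.real_distribution_distr prob) simp
  have "tight Q"
    unfolding tight_def
  proof (intro conjI allI impI Q)
    fix e :: real assume "e > 0"
    have "measure (Q n) {-1<..1} = 1" for n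
    proof -
      interpret prob_space "P n" by (rule prob)
      have "-1 < T x" for x using T0[of x] by linarith
      then have "T -` {-1<..1} \<inter> space (P n) = space (P n)" using T1 by auto
      then show ?thesis unfolding Q_def by (simp add: measure_distr prob_space)
    qed
    then show "\<exists>a b. a < b \<and> (\<forall>n. 1 - e < measure (Q n) {a<..b})"
      using \<open>e > 0\<close> by (intro exI[of _ "-1"] exI[of _ 1]) auto
  qed
  then obtain r M where r: "strict_mono (r :: nat \<Rightarrow> nat)" and M: "real_distribution M"
    and w: "weak_conv_m (Q \<circ> id \<circ> r) M"
    using tight_imp_convergent_subsubsequence[of Q id] strict_mono_id by auto
  have Qr: "real_distribution ((Q \<circ> id \<circ> r) n)" for n by (simp add: Q)
  obtain \<Omega> :: "real measure" and W :: "nat \<Rightarrow> real \<Rightarrow> real" and W' where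
    \<Omega>: "prob_space \<Omega>" and W[measurable]: "\<And>n. W n \<in> borel_measurable \<Omega>"
    and dW: "\<And>n. distr \<Omega> borel (W n) = Q (r n)"
    and WW: "\<And>x. x \<in> space \<Omega> \<Longrightarrow> (\<lambda>n. W n x) \<longlonglongrightarrow> W' x"
    using Skorohod[OF Qr M w] by (simp, blast)
  interpret prob_space \<Omega> by fact
  define Z where "Z n \<omega> = g (W n \<omega>)" for n \<omega>
  have Z[measurable]: "Z n \<in> borel_measurable \<Omega>" for n unfolding Z_def by measurable
  have dZ: "distr \<Omega> borel (Z n) = P (r n)" for n
  proof -
    have "distr \<Omega> borel (Z n) = distr (distr \<Omega> borel (W n)) borel g"
      by (subst distr_distr) (auto simp: Z_def[abs_def] comp_def)
    also have "\<dots> = distr (P (r n)) borel (\<lambda>v. g (T v))"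
      unfolding dW Q_def by (subst distr_distr) (auto simp: comp_def)
    also have "\<dots> = P (r n)" unfolding gT by (simp add: distr_id2 sets)
    finally show ?thesis .
  qed
  \<comment> \<open>Decoding is a left inverse of \<open>T\<close> only, but \<open>W n\<close> has
    the law of a code and so lies almost surely in the range of \<open>T\<close>.\<close>
  have "AE \<omega> in \<Omega>. T (Z n \<omega>) = W n \<omega>" for n
  proof -
    have "AE t in Q (r n). T (g t) = t" unfolding Q_def by (subst AE_distr_iff) (auto simp: gT)
    then show ?thesis unfolding dW[symmetric] Z_def by (subst (asm) AE_distr_iff) auto
  qed
  then have TZ: "AE \<omega> in \<Omega>. \<forall>n. T (Z n \<omega>) = W n \<omega>" by (simp add: AE_all_countable)
  have "(\<integral>\<^sup>+ \<omega>. liminf (\<lambda>n. ennreal ((norm (Z n \<omega>))\<^sup>2)) \<partial>\<Omega>)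
      \<le> liminf (\<lambda>n. \<integral>\<^sup>+ \<omega>. ennreal ((norm (Z n \<omega>))\<^sup>2) \<partial>\<Omega>)"
    by (rule nn_integral_liminf) measurable
  also have "\<dots> \<le> liminf (\<lambda>n. ennreal C)"
  proof (intro Liminf_mono always_eventually allI)
    fix n
    have "(\<integral>\<^sup>+ \<omega>. ennreal ((norm (Z n \<omega>))\<^sup>2) \<partial>\<Omega>) = (\<integral>\<^sup>+ z. ennreal ((norm z)\<^sup>2) \<partial>P (r n))"
      unfolding dZ[symmetric] by (subst nn_integral_distr) auto
    then show "(\<integral>\<^sup>+ \<omega>. ennreal ((norm (Z n \<omega>))\<^sup>2) \<partial>\<Omega>) \<le> ennreal C" using bound by simp
  qed
  also have "\<dots> < \<infinity>" by (simp add: Liminf_const)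
  finally have "AE \<omega> in \<Omega>. liminf (\<lambda>n. ennreal ((norm (Z n \<omega>))\<^sup>2)) \<noteq> \<infinity>"
    by (intro nn_integral_PInf_AE) auto
  then have AEc: "AE \<omega> in \<Omega>. convergent (\<lambda>n. Z n \<omega>)"
    using TZ AE_space
  proof eventually_elim
    case (elim \<omega>)
    then obtain c where c: "liminf (\<lambda>n. ennreal ((norm (Z n \<omega>))\<^sup>2)) = ennreal c" "c \<ge> 0"
      by (cases "liminf (\<lambda>n. ennreal ((norm (Z n \<omega>))\<^sup>2))") auto
    show ?case
    \<comment> \<open>If the norms eventually exceeded this bound, the limit inferior of their
      squares would be at least c + 1 instead of c.\<close>
    proof (rule conv[where B = "sqrt (c + 1)"])
      show "convergent (\<lambda>n. T (Z n \<omega>))" using elim WW[of \<omega>] by (auto intro: convergentI)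
      show "\<forall>N. \<exists>n\<ge>N. norm (Z n \<omega>) \<le> sqrt (c + 1)"
      proof (rule ccontr)
        assume "\<not> ?thesis"
        then obtain N where N: "\<And>n. n \<ge> N \<Longrightarrow> sqrt (c + 1) < norm (Z n \<omega>)" by (metis not_le)
        have "ennreal (c + 1) \<le> liminf (\<lambda>n. ennreal ((norm (Z n \<omega>))\<^sup>2))"
        proof (intro Liminf_bounded eventually_sequentiallyI)
          fix n assume "n \<ge> N"
          then have "sqrt (c + 1) < norm (Z n \<omega>)" by (rule N)
          then have "(sqrt (c + 1))\<^sup>2 \<le> (norm (Z n \<omega>))\<^sup>2" using c(2) by (intro power_mono) auto
          then show "ennreal (c + 1) \<le> ennreal ((norm (Z n \<omega>))\<^sup>2)"
            using c(2) by (intro ennreal_leI) simp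
        qed
        then show False using c by simp
      qed
    qed
  qed
  show thesis
  proof (rule that[OF r \<Omega> Z _ dZ])
    show "(\<lambda>\<omega>. lim (\<lambda>n. Z n \<omega>)) \<in> borel_measurable \<Omega>" by (rule borel_measurable_lim_metric) simp
    show "AE \<omega> in \<Omega>. (\<lambda>n. Z n \<omega>) \<longlonglongrightarrow> lim (\<lambda>n. Z n \<omega>)"
      using AEc by (simp add: convergent_LIMSEQ_iff)
  qed
qed

section \<open>Martingale couplings\<close>

lemma subalgebra_vimage_algebra:
  assumes "X \<in> measurable M N"
  shows "subalgebra M (vimage_algebra (space M) X N)"
  using measurable_space[OF assms] measurable_sets[OF assms]
  by (auto simp: subalgebra_def sets_vimage_algebra2)

lemma finite_measure_subalgebra_vimage_algebra:
  assumes "prob_space M" "X \<in> measurable M N"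
  shows "finite_measure_subalgebra M (vimage_algebra (space M) X N)"
  using assms subalgebra_vimage_algebra
  by (auto simp: finite_measure_subalgebra_def finite_measure_subalgebra_axioms_def
      intro: prob_space.finite_measure)

text \<open>The sets of the generated sigma-algebra are exactly the preimages of Borel sets, so the
  conditional expectation is characterised by integrals of functions of X. Such identities, unlike
  conditional expectations, are carried along image measures and through limits.\<close>

lemma real_cond_exp_vimage_algebra_iff:
  fixes X :: "'a \<Rightarrow> 'b::topological_space" and f :: "'a \<Rightarrow> real"
  assumes M: "prob_space M" and X[measurable]: "X \<in> borel_measurable M"
    and f: "integrable M f" and g[measurable]: "g \<in> borel_measurable borel"
    and gX: "integrable M (\<lambda>\<omega>. g (X \<omega>))"
  shows "(AE \<omega> in M. real_cond_exp M (vimage_algebra (space M) X borel) f \<omega> = g (X \<omega>)) \<longleftrightarrow>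
    (\<forall>B\<in>sets borel. (\<integral>\<omega>. indicator B (X \<omega>) * f \<omega> \<partial>M) = (\<integral>\<omega>. indicator B (X \<omega>) * g (X \<omega>) \<partial>M))"
    (is "?L \<longleftrightarrow> ?R")
proof -
  let ?F = "vimage_algebra (space M) X borel"
  interpret prob_space M by fact
  interpret finite_measure_subalgebra M ?F
    using M X by (rule finite_measure_subalgebra_vimage_algebra)
  have XF[measurable]: "X \<in> borel_measurable ?F" by (rule measurable_vimage_algebra1) simp
  have [measurable]: "f \<in> borel_measurable M" using f by (rule borel_measurable_integrable)
  show ?thesis
  proof
    assume L: ?L
    show ?R
    proof
      fix B :: "'b set" assume B[measurable]: "B \<in> sets borel"
      have "integrable M (\<lambda>\<omega>. indicator B (X \<omega>) * f \<omega>)"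
        by (rule Bochner_Integration.integrable_bound[OF f]) (auto simp: indicator_def)
      then have "(\<integral>\<omega>. indicator B (X \<omega>) * f \<omega> \<partial>M)
          = (\<integral>\<omega>. indicator B (X \<omega>) * real_cond_exp M ?F f \<omega> \<partial>M)"
        by (intro real_cond_exp_intg(2)[symmetric]) measurable
      also have "\<dots> = (\<integral>\<omega>. indicator B (X \<omega>) * g (X \<omega>) \<partial>M)"
        by (rule integral_cong_AE) (use L in auto)
      finally show "(\<integral>\<omega>. indicator B (X \<omega>) * f \<omega> \<partial>M) = (\<integral>\<omega>. indicator B (X \<omega>) * g (X \<omega>) \<partial>M)" .
    qed
  next
    assume R: ?R
    show ?L
    proof (rule real_cond_exp_charact[OF _ f gX])
      fix A assume "A \<in> sets ?F"
      then obtain B where B: "B \<in> sets borel" "A = X -` B \<inter> space M"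
        by (auto simp: sets_vimage_algebra2)
      have "(\<integral>\<omega>\<in>A. h \<omega> \<partial>M) = (\<integral>\<omega>. indicator B (X \<omega>) * h \<omega> \<partial>M)" for h :: "'a \<Rightarrow> real"
        unfolding set_lebesgue_integral_def
        by (rule Bochner_Integration.integral_cong) (auto simp: B(2) indicator_def)
      then show "(\<integral>\<omega>\<in>A. f \<omega> \<partial>M) = (\<integral>\<omega>\<in>A. g (X \<omega>) \<partial>M)" using R B(1) by simp
    qed measurable
  qed
qed

section \<open>Integrability from second moments\<close>

lemma (in finite_measure) integrable_of_square_integrable:
  fixes f :: "'a \<Rightarrow> 'b::{banach, second_countable_topology}"
  assumes [measurable]: "f \<in> borel_measurable M" and sq: "integrable M (\<lambda>\<omega>. (norm (f \<omega>))\<^sup>2)"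
  shows "integrable M f"
proof (rule Bochner_Integration.integrable_bound)
  show "integrable M (\<lambda>\<omega>. 1 + (norm (f \<omega>))\<^sup>2)" using sq by simp
  have "x \<le> 1 + x\<^sup>2" for x :: real using zero_le_power2[of "x - 1/2"] by (simp add: power2_eq_square algebra_simps)
  then show "AE x in M. norm (f x) \<le> norm (1 + (norm (f x))\<^sup>2)" by simp
qed simp

lemma integrable_mult_of_squares:
  fixes f g :: "'a \<Rightarrow> real"
  assumes [measurable]: "f \<in> borel_measurable M" "g \<in> borel_measurable M"
    and sq: "integrable M (\<lambda>\<omega>. (f \<omega>)\<^sup>2)" "integrable M (\<lambda>\<omega>. (g \<omega>)\<^sup>2)"
  shows "integrable M (\<lambda>\<omega>. f \<omega> * g \<omega>)"
proof (rule Bochner_Integration.integrable_bound)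
  show "integrable M (\<lambda>\<omega>. (f \<omega>)\<^sup>2 + (g \<omega>)\<^sup>2)" using sq by simp
  have "\<bar>x * y\<bar> \<le> x\<^sup>2 + y\<^sup>2" for x y :: real
  proof -
    have "2 * (\<bar>x\<bar> * \<bar>y\<bar>) \<le> x\<^sup>2 + y\<^sup>2" using sum_squares_bound[of "\<bar>x\<bar>" "\<bar>y\<bar>"] by simp
    moreover have "0 \<le> \<bar>x\<bar> * \<bar>y\<bar>" by simp
    ultimately show ?thesis unfolding abs_mult by linarith
  qed
  then show "AE x in M. norm (f x * g x) \<le> norm ((f x)\<^sup>2 + (g x)\<^sup>2)" by simp
qed simp

lemma component_square_le: "(x $ i)\<^sup>2 \<le> (norm (x :: real^'n))\<^sup>2"
  using component_le_norm_cart[of x i] abs_le_square_iff[of "x $ i" "norm x"] by simp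

lemma borel_measurable_vec_nth'[measurable (raw)]:
  "f \<in> borel_measurable M \<Longrightarrow> (\<lambda>x. (f x :: real^'n) $ i) \<in> borel_measurable M"
  by (rule borel_measurable_continuous_on[where f = "\<lambda>v. v $ i"]) (auto intro: continuous_intros)

lemma integrable_component_square:
  fixes f :: "'a \<Rightarrow> real^'n"
  assumes [measurable]: "f \<in> borel_measurable M" and sq: "integrable M (\<lambda>\<omega>. (norm (f \<omega>))\<^sup>2)"
  shows "integrable M (\<lambda>\<omega>. (f \<omega> $ i)\<^sup>2)"
  by (rule Bochner_Integration.integrable_bound[OF sq]) (auto simp: component_square_le)

lemma (in finite_measure) integrable_component:
  fixes f :: "'a \<Rightarrow> real^'n"
  assumes [measurable]: "f \<in> borel_measurable M" and sq: "integrable M (\<lambda>\<omega>. (norm (f \<omega>))\<^sup>2)"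
  shows "integrable M (\<lambda>\<omega>. f \<omega> $ i)"
  by (rule integrable_of_square_integrable) (use integrable_component_square[OF assms] in auto)

lemma martingale_iff:
  fixes X Y :: "'a \<Rightarrow> real^'n"
  assumes M: "prob_space M" and X[measurable]: "X \<in> borel_measurable M" "Y \<in> borel_measurable M"
    and "integrable M (\<lambda>\<omega>. (norm (X \<omega>))\<^sup>2)" "integrable M (\<lambda>\<omega>. (norm (Y \<omega>))\<^sup>2)"
  shows "(AE \<omega> in M. real_cond_exp M (vimage_algebra (space M) X borel) (\<lambda>\<omega>. Y \<omega> $ i) \<omega> = X \<omega> $ i) \<longleftrightarrow>
    (\<forall>B\<in>sets borel. (\<integral>\<omega>. indicator B (X \<omega>) * Y \<omega> $ i \<partial>M) = (\<integral>\<omega>. indicator B (X \<omega>) * X \<omega> $ i \<partial>M))"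
proof -
  interpret prob_space M by fact
  show ?thesis
    by (rule real_cond_exp_vimage_algebra_iff[OF M X(1) _ _, where g = "\<lambda>v. v $ i"])
      (use assms in \<open>auto intro!: integrable_component\<close>)
qed

lemma borel_measurable_fst_snd[measurable]:
  "(fst :: 'a::second_countable_topology \<times> 'b::second_countable_topology \<Rightarrow> 'a) \<in> borel_measurable borel"
  "(snd :: 'a::second_countable_topology \<times> 'b::second_countable_topology \<Rightarrow> 'b) \<in> borel_measurable borel"
  by (auto intro!: borel_measurable_continuous_onI continuous_intros)

lemma MGamma_iff:
  fixes \<gamma> :: "((real^'n) \<times> (real^'n)) measure"
  shows "\<gamma> \<in> MGamma \<nu> \<longleftrightarrow> prob_space \<gamma> \<and> sets \<gamma> = sets borel \<and>
     integrable \<gamma> (\<lambda>p. (norm (fst p))\<^sup>2) \<and> integrable \<gamma> (\<lambda>p. (norm (snd p))\<^sup>2) \<and>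
     distr \<gamma> borel snd = \<nu> \<and>
     (\<forall>i. \<forall>B\<in>sets borel. (\<integral>p. indicator B (fst p) * snd p $ i \<partial>\<gamma>) = (\<integral>p. indicator B (fst p) * fst p $ i \<partial>\<gamma>))"
proof -
  have m: "fst \<in> borel_measurable \<gamma>" "snd \<in> borel_measurable \<gamma>" if [measurable_cong]: "sets \<gamma> = sets borel"
    by measurable
  show ?thesis
    unfolding MGamma_def using m by (auto simp: martingale_iff)
qed

text \<open>All couplings constructed below arise in this way: from the elements of
  \<open>Xset M Y\<close>, from the limit of a maximizing sequence, and from the pair (Y,
  Y).\<close>

lemma distr_Pair_in_MGamma:
  fixes X Y :: "'a \<Rightarrow> real^'n"
  assumes "prob_space M" and [measurable]: "X \<in> borel_measurable M" "Y \<in> borel_measurable M"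
    and "integrable M (\<lambda>\<omega>. (norm (X \<omega>))\<^sup>2)" "integrable M (\<lambda>\<omega>. (norm (Y \<omega>))\<^sup>2)"
    and "\<And>i B. B \<in> sets borel \<Longrightarrow>
      (\<integral>\<omega>. indicator B (X \<omega>) * Y \<omega> $ i \<partial>M) = (\<integral>\<omega>. indicator B (X \<omega>) * X \<omega> $ i \<partial>M)"
  shows "distr M borel (\<lambda>\<omega>. (X \<omega>, Y \<omega>)) \<in> MGamma (distr M borel Y)"
proof -
  interpret prob_space M by fact
  have XY[measurable]: "(\<lambda>\<omega>. (X \<omega>, Y \<omega>)) \<in> borel_measurable M" by simp
  show ?thesis
    unfolding MGamma_iff using assms
    by (auto simp: integrable_distr_eq integral_distr distr_distr comp_def intro!: prob_space_distr)
qed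

section \<open>Passage to the limit\<close>

text \<open>Indicators of Borel sets are not compatible with convergence of their arguments,
  continuous test functions are. This lemma returns from the latter to the former: indicators of
  closed sets are limits of continuous functions, and closed sets form an intersection-stable
  generator of the Borel sets.\<close>

lemma indicator_integral_eqI_continuous:
  fixes X :: "'a \<Rightarrow> 'c::metric_space" and X' :: "'b \<Rightarrow> 'c" and f :: "'a \<Rightarrow> real" and f' :: "'b \<Rightarrow> real"
  assumes X[measurable]: "X \<in> borel_measurable M" "X' \<in> borel_measurable M'"
    and f: "integrable M f" "integrable M' f'"
    and eq: "\<And>\<phi>. continuous_on UNIV \<phi> \<Longrightarrow> (\<And>x. 0 \<le> \<phi> x \<and> \<phi> x \<le> (1::real)) \<Longrightarrow>
      (\<integral>\<omega>. \<phi> (X \<omega>) * f \<omega> \<partial>M) = (\<integral>\<omega>. \<phi> (X' \<omega>) * f' \<omega> \<partial>M')"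
    and B: "B \<in> sets borel"
  shows "(\<integral>\<omega>. indicator B (X \<omega>) * f \<omega> \<partial>M) = (\<integral>\<omega>. indicator B (X' \<omega>) * f' \<omega> \<partial>M')"
proof -
  have [measurable]: "f \<in> borel_measurable M" "f' \<in> borel_measurable M'"
    using f by (auto intro: borel_measurable_integrable)
  have int: "integrable N (\<lambda>\<omega>. indicator A (W \<omega>) * h \<omega>)"
    if [measurable]: "A \<in> sets borel" "W \<in> borel_measurable N" and h: "integrable N h"
    for A :: "'c set" and N :: "'d measure" and W and h :: "'d \<Rightarrow> real"
  proof (rule Bochner_Integration.integrable_bound[OF h])
    have [measurable]: "h \<in> borel_measurable N" using h by (rule borel_measurable_integrable)
    show "(\<lambda>\<omega>. indicator A (W \<omega>) * h \<omega>) \<in> borel_measurable N" by measurable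
  qed (auto simp: indicator_def)
  have sums: "(\<integral>\<omega>. indicator (\<Union>i. A i) (W \<omega>) * h \<omega> \<partial>N) = (\<Sum>i. \<integral>\<omega>. indicator (A i) (W \<omega>) * h \<omega> \<partial>N)"
    if A: "disjoint_family A" "\<And>i::nat. A i \<in> sets borel" and W[measurable]: "W \<in> borel_measurable N"
      and h: "integrable N h"
    for A :: "nat \<Rightarrow> 'c set" and N :: "'d measure" and W and h :: "'d \<Rightarrow> real"
  proof -
    have *: "(\<integral>\<omega>. indicator C (W \<omega>) * h \<omega> \<partial>N) = (LINT \<omega>:(W -` C \<inter> space N)|N. h \<omega>)" for C
      unfolding set_lebesgue_integral_def
      by (rule Bochner_Integration.integral_cong) (auto simp: indicator_def)
    have U: "W -` (\<Union>i. A i) \<inter> space N = (\<Union>i. W -` A i \<inter> space N)" by auto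
    show ?thesis
      unfolding * U
    proof (rule lebesgue_integral_countable_add)
      show "W -` A i \<inter> space N \<in> sets N" for i using W A(2) by (rule measurable_sets)
      show "W -` A i \<inter> space N \<inter> (W -` A j \<inter> space N) = {}" if "i \<noteq> j" for i j
        using A(1) that by (auto simp: disjoint_family_on_def)
      show "set_integrable N (\<Union>i. W -` A i \<inter> space N) h"
        unfolding U[symmetric] set_integrable_def
      proof (rule integrable_mult_indicator[OF _ h])
        show "W -` (\<Union>i. A i) \<inter> space N \<in> sets N" using A(2) by (intro measurable_sets[OF W]) auto
      qed
    qed
  qed
  have lim: "(\<lambda>k. \<integral>\<omega>. max 0 (1 - real k * infdist (W \<omega>) A) * h \<omega> \<partial>N) \<longlonglongrightarrow> (\<integral>\<omega>. indicator A (W \<omega>) * h \<omega> \<partial>N)"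
    if A: "closed A" "A \<noteq> {}" and W[measurable]: "W \<in> borel_measurable N"
      and h: "integrable N h"
    for A :: "'c set" and N :: "'d measure" and W and h :: "'d \<Rightarrow> real"
  proof (rule integral_dominated_convergence[where w = "\<lambda>\<omega>. \<bar>h \<omega>\<bar>"])
    have [measurable]: "h \<in> borel_measurable N" using h by (rule borel_measurable_integrable)
    have [measurable]: "(\<lambda>x. infdist x A) \<in> borel_measurable borel"
      by (intro borel_measurable_continuous_onI continuous_intros)
    have [measurable]: "A \<in> sets borel" using A by simp
    show "(\<lambda>\<omega>. indicator A (W \<omega>) * h \<omega>) \<in> borel_measurable N" by measurable
    show "(\<lambda>\<omega>. max 0 (1 - real k * infdist (W \<omega>) A) * h \<omega>) \<in> borel_measurable N" for k by measurable
    show "integrable N (\<lambda>\<omega>. \<bar>h \<omega>\<bar>)" using h by simp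
    show "AE \<omega> in N. norm (max 0 (1 - real k * infdist (W \<omega>) A) * h \<omega>) \<le> \<bar>h \<omega>\<bar>" for k
      by (intro AE_I2) (auto simp: abs_mult infdist_nonneg intro!: mult_left_le_one_le)
    have "(\<lambda>k. max 0 (1 - real k * infdist x A)) \<longlonglongrightarrow> indicator A x" for x
    proof (cases "x \<in> A")
      case True
      then show ?thesis using A by simp
    next
      case False
      then have pos: "infdist x A > 0" using A by (metis in_closed_iff_infdist_zero infdist_nonneg order_less_le)
      obtain K where K: "1 / infdist x A < real K" using reals_Archimedean2 by blast
      have "\<forall>\<^sub>F k in sequentially. max 0 (1 - real k * infdist x A) = indicator A x"
      proof (rule eventually_sequentiallyI[of K])
        fix k assume "K \<le> k"
        then have "1 / infdist x A < real k" using K by linarith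
        then have "1 < real k * infdist x A" using pos by (simp add: field_simps)
        then show "max 0 (1 - real k * infdist x A) = indicator A x" using False by simp
      qed
      then show ?thesis by (rule tendsto_eventually)
    qed
    then show "AE \<omega> in N. (\<lambda>k. max 0 (1 - real k * infdist (W \<omega>) A) * h \<omega>) \<longlonglongrightarrow> indicator A (W \<omega>) * h \<omega>"
      by (intro AE_I2 tendsto_mult tendsto_const)
  qed
  have "Int_stable (Collect closed :: 'c set set)" by (auto simp: Int_stable_def)
  moreover have "(Collect closed :: 'c set set) \<subseteq> Pow UNIV" by simp
  moreover have "B \<in> sigma_sets UNIV (Collect closed)" using B by (simp add: borel_eq_closed)
  ultimately show ?thesis
  proof (induction B rule: sigma_sets_induct_disjoint)
    case (basic A)
    \<comment> \<open>The empty set is treated apart: \<open>infdist\<close> to it is 0 by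
      convention, so the approximating functions would be constantly 1.\<close>
    show ?case
    proof (cases "A = {}")
      case False
      have A: "closed A" using basic by simp
      have "(\<lambda>k. \<integral>\<omega>. max 0 (1 - real k * infdist (X \<omega>) A) * f \<omega> \<partial>M) =
          (\<lambda>k. \<integral>\<omega>. max 0 (1 - real k * infdist (X' \<omega>) A) * f' \<omega> \<partial>M')"
        by (intro ext eq) (auto intro!: continuous_intros simp: infdist_nonneg)
      with lim[OF A False X(1) f(1)] lim[OF A False X(2) f(2)] show ?thesis
        by (simp add: LIMSEQ_unique)
    qed simp
  next
    case (compl A)
    then have [measurable]: "A \<in> sets borel" by (simp add: borel_eq_closed)
    have c: "indicator (UNIV - A) x * y = y - indicator A x * y" for x and y :: real
      by (simp add: indicator_def)
    have "(\<integral>\<omega>. f \<omega> \<partial>M) = (\<integral>\<omega>. f' \<omega> \<partial>M')" using eq[of "\<lambda>_. 1"] by simp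
    then show ?case
      unfolding c using int[of A X M f] int[of A X' M' f'] f compl(2) by simp
  next
    case (union A)
    then have "A i \<in> sets borel" for i by (auto simp: borel_eq_closed)
    then show ?case
      using union sums[of A X M f] sums[of A X' M' f'] f by simp
  qed auto
qed

section \<open>Truncation and uniform integrability\<close>

definition clip :: "real \<Rightarrow> real \<Rightarrow> real" where
  "clip k x = max (- k) (min k x)"

lemma abs_clip_le: "k \<ge> 0 \<Longrightarrow> \<bar>clip k x\<bar> \<le> k" "k \<ge> 0 \<Longrightarrow> \<bar>x - clip k x\<bar> \<le> \<bar>x\<bar>"
  "k \<ge> 0 \<Longrightarrow> \<bar>x\<bar> \<le> k \<Longrightarrow> clip k x = x"
  by (auto simp: clip_def)

text \<open>Where truncation acts, \<bar>x\<bar> exceeds k, so \<bar>x\<bar> k is at most the square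
  of x. A common second moment bound therefore makes the truncation error uniformly small.\<close>

lemma abs_diff_clip_le:
  assumes "k > 0"
  shows "\<bar>x - clip k x\<bar> \<le> x\<^sup>2 / k"
proof (cases "\<bar>x\<bar> \<le> k")
  case False
  then have "\<bar>x\<bar> * k \<le> \<bar>x\<bar> * \<bar>x\<bar>" by (intro mult_left_mono) auto
  then have "\<bar>x\<bar> * k \<le> x\<^sup>2" by (simp add: power2_eq_square)
  then have "\<bar>x\<bar> \<le> x\<^sup>2 / k" using assms by (simp add: field_simps)
  then show ?thesis using abs_clip_le(2)[of k x] assms by simp
qed (use assms abs_clip_le(3)[of k x] in auto)

lemma borel_measurable_clip[measurable]: "clip k \<in> borel_measurable borel"
  unfolding clip_def[abs_def] by measurable

lemma tendsto_clip: "(f \<longlongrightarrow> l) F \<Longrightarrow> ((\<lambda>x. clip k (f x)) \<longlongrightarrow> clip k l) F"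
  unfolding clip_def by (intro tendsto_intros)

text \<open>An interchange of limits: the approximating sequence and its limit may depend on e, as
  long as the error is uniform in n. It is applied with truncated integrands.\<close>

lemma LIMSEQ_uniform_approx:
  fixes a :: "nat \<Rightarrow> real"
  assumes "\<And>e. e > 0 \<Longrightarrow> \<exists>b l'. b \<longlonglongrightarrow> l' \<and> (\<forall>n. \<bar>a n - b n\<bar> \<le> e) \<and> \<bar>l - l'\<bar> \<le> e"
  shows "a \<longlonglongrightarrow> l"
proof (rule LIMSEQ_I)
  fix e :: real assume "e > 0"
  then obtain b l' where b: "b \<longlonglongrightarrow> l'" "\<And>n. \<bar>a n - b n\<bar> \<le> e/4" "\<bar>l - l'\<bar> \<le> e/4"
    using assms[of "e/4"] by auto
  from LIMSEQ_D[OF b(1), of "e/4"] \<open>e > 0\<close>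
  obtain N where N: "\<And>n. n \<ge> N \<Longrightarrow> \<bar>b n - l'\<bar> < e/4" by auto
  have "\<bar>a n - l\<bar> < e" if "n \<ge> N" for n using N[OF that] b(2)[of n] b(3) \<open>e > 0\<close> by linarith
  then show "\<exists>no. \<forall>n\<ge>no. norm (a n - l) < e" by auto
qed

lemma (in prob_space) L2_bounded_limit:
  fixes U :: "nat \<Rightarrow> 'a \<Rightarrow> 'b::{real_normed_vector, second_countable_topology}"
  assumes [measurable]: "\<And>n. U n \<in> borel_measurable M" "V \<in> borel_measurable M"
    and int: "\<And>n. integrable M (\<lambda>\<omega>. (norm (U n \<omega>))\<^sup>2)" and bd: "\<And>n. (\<integral>\<omega>. (norm (U n \<omega>))\<^sup>2 \<partial>M) \<le> C"
    and lim: "AE \<omega> in M. (\<lambda>n. U n \<omega>) \<longlonglongrightarrow> V \<omega>"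
  shows "integrable M (\<lambda>\<omega>. (norm (V \<omega>))\<^sup>2)" "(\<integral>\<omega>. (norm (V \<omega>))\<^sup>2 \<partial>M) \<le> C"
proof -
  have C: "C \<ge> 0" using bd[of 0] by (rule order_trans[rotated]) simp
  have "(\<integral>\<^sup>+\<omega>. ennreal ((norm (V \<omega>))\<^sup>2) \<partial>M) = (\<integral>\<^sup>+\<omega>. liminf (\<lambda>n. ennreal ((norm (U n \<omega>))\<^sup>2)) \<partial>M)"
  proof (rule nn_integral_cong_AE)
    show "AE \<omega> in M. ennreal ((norm (V \<omega>))\<^sup>2) = liminf (\<lambda>n. ennreal ((norm (U n \<omega>))\<^sup>2))"
      using lim
    proof eventually_elim
      case (elim \<omega>)
      then have "(\<lambda>n. ennreal ((norm (U n \<omega>))\<^sup>2)) \<longlonglongrightarrow> ennreal ((norm (V \<omega>))\<^sup>2)"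
        by (intro tendsto_ennrealI tendsto_intros)
      from lim_imp_Liminf[OF _ this] show ?case by simp
    qed
  qed
  also have "\<dots> \<le> liminf (\<lambda>n. \<integral>\<^sup>+\<omega>. ennreal ((norm (U n \<omega>))\<^sup>2) \<partial>M)"
    by (rule nn_integral_liminf) measurable
  also have "\<dots> \<le> liminf (\<lambda>n. ennreal C)"
    by (intro Liminf_mono always_eventually allI)
      (simp add: nn_integral_eq_integral[OF int] ennreal_leI bd)
  finally have le: "(\<integral>\<^sup>+\<omega>. ennreal ((norm (V \<omega>))\<^sup>2) \<partial>M) \<le> ennreal C" by (simp add: Liminf_const)
  show i: "integrable M (\<lambda>\<omega>. (norm (V \<omega>))\<^sup>2)"
    by (rule integrableI_bounded) (use le in \<open>auto intro: le_less_trans\<close>)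
  show "(\<integral>\<omega>. (norm (V \<omega>))\<^sup>2 \<partial>M) \<le> C"
    using le C unfolding nn_integral_eq_integral[OF i, simplified] by simp
qed

text \<open>Boundedness in L2 implies uniform integrability: the clipped variables converge by
  dominated convergence, and clipping changes every integral by at most C / k.\<close>

lemma (in prob_space) tendsto_integral_L2_bounded:
  fixes U :: "nat \<Rightarrow> 'a \<Rightarrow> real"
  assumes [measurable]: "\<And>n. U n \<in> borel_measurable M" "V \<in> borel_measurable M"
    and int: "\<And>n. integrable M (\<lambda>\<omega>. (U n \<omega>)\<^sup>2)" and bd: "\<And>n. (\<integral>\<omega>. (U n \<omega>)\<^sup>2 \<partial>M) \<le> C"
    and lim: "AE \<omega> in M. (\<lambda>n. U n \<omega>) \<longlonglongrightarrow> V \<omega>"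
  shows "(\<lambda>n. \<integral>\<omega>. U n \<omega> \<partial>M) \<longlonglongrightarrow> (\<integral>\<omega>. V \<omega> \<partial>M)"
proof (rule LIMSEQ_uniform_approx)
  fix e :: real assume "e > 0"
  have C: "C \<ge> 0" using bd[of 0] by (rule order_trans[rotated]) simp
  define k where "k = (C + 1) / e"
  have k: "k > 0" "C / k \<le> e" using C \<open>e > 0\<close> by (auto simp: k_def field_simps)
  have V: "integrable M (\<lambda>\<omega>. (V \<omega>)\<^sup>2)" "(\<integral>\<omega>. (V \<omega>)\<^sup>2 \<partial>M) \<le> C"
    using L2_bounded_limit[of U V C] assms by simp_all
  have err: "\<bar>(\<integral>\<omega>. W \<omega> \<partial>M) - (\<integral>\<omega>. clip k (W \<omega>) \<partial>M)\<bar> \<le> e"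
    if [measurable]: "W \<in> borel_measurable M" and W: "integrable M (\<lambda>\<omega>. (W \<omega>)\<^sup>2)" "(\<integral>\<omega>. (W \<omega>)\<^sup>2 \<partial>M) \<le> C" for W
  proof -
    have iW: "integrable M W" by (rule integrable_of_square_integrable) (use W in auto)
    have ic: "integrable M (\<lambda>\<omega>. clip k (W \<omega>))"
      by (rule integrable_const_bound[of _ k]) (use abs_clip_le(1)[of k] k in auto)
    have "\<bar>(\<integral>\<omega>. W \<omega> \<partial>M) - (\<integral>\<omega>. clip k (W \<omega>) \<partial>M)\<bar> = \<bar>\<integral>\<omega>. W \<omega> - clip k (W \<omega>) \<partial>M\<bar>"
      using iW ic by simp
    also have "\<dots> \<le> (\<integral>\<omega>. \<bar>W \<omega> - clip k (W \<omega>)\<bar> \<partial>M)" by (rule integral_abs_bound)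
    also have "\<dots> \<le> (\<integral>\<omega>. (W \<omega>)\<^sup>2 / k \<partial>M)"
      by (rule integral_mono) (use iW ic W(1) abs_diff_clip_le[OF k(1)] in auto)
    also have "\<dots> \<le> C / k" using W(2) k(1) by (simp add: divide_right_mono)
    finally show ?thesis using k(2) by simp
  qed
  show "\<exists>b l'. b \<longlonglongrightarrow> l' \<and> (\<forall>n. \<bar>(\<integral>\<omega>. U n \<omega> \<partial>M) - b n\<bar> \<le> e) \<and> \<bar>(\<integral>\<omega>. V \<omega> \<partial>M) - l'\<bar> \<le> e"
  proof (intro exI conjI allI)
    show "(\<lambda>n. \<integral>\<omega>. clip k (U n \<omega>) \<partial>M) \<longlonglongrightarrow> (\<integral>\<omega>. clip k (V \<omega>) \<partial>M)"
      by (rule integral_dominated_convergence[where w = "\<lambda>_. k"])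
        (use lim abs_clip_le(1)[of k] k in \<open>auto intro: tendsto_clip elim!: eventually_mono\<close>)
  qed (use assms V in \<open>auto intro!: err\<close>)
qed

text \<open>The squares of the factors of constant law are uniformly integrable, so that mere
  boundedness in \<open>L\<^sup>2\<close> suffices for the other factor.\<close>

lemma (in prob_space) tendsto_integral_mult_same_law:
  fixes U V :: "nat \<Rightarrow> 'a \<Rightarrow> real"
  assumes [measurable]: "\<And>n. U n \<in> borel_measurable M" "\<And>n. V n \<in> borel_measurable M"
      "U' \<in> borel_measurable M" "V' \<in> borel_measurable M"
    and int: "\<And>n. integrable M (\<lambda>\<omega>. (U n \<omega>)\<^sup>2)" and bd: "\<And>n. (\<integral>\<omega>. (U n \<omega>)\<^sup>2 \<partial>M) \<le> C"
    and int': "integrable M (\<lambda>\<omega>. (V' \<omega>)\<^sup>2)" and law: "\<And>n. distr M borel (V n) = distr M borel V'"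
    and lim: "AE \<omega> in M. (\<lambda>n. U n \<omega>) \<longlonglongrightarrow> U' \<omega>" "AE \<omega> in M. (\<lambda>n. V n \<omega>) \<longlonglongrightarrow> V' \<omega>"
  shows "(\<lambda>n. \<integral>\<omega>. U n \<omega> * V n \<omega> \<partial>M) \<longlonglongrightarrow> (\<integral>\<omega>. U' \<omega> * V' \<omega> \<partial>M)"
proof (rule LIMSEQ_uniform_approx)
  fix e :: real assume e: "e > 0"
  have C: "C \<ge> 0" using bd[of 0] by (rule order_trans[rotated]) simp
  have U': "integrable M (\<lambda>\<omega>. (U' \<omega>)\<^sup>2)" "(\<integral>\<omega>. (U' \<omega>)\<^sup>2 \<partial>M) \<le> C"
    using L2_bounded_limit[of U U' C] assms by simp_all
  \<comment> \<open>This truncation error depends only on the law, so it is the same for every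
    \<open>V n\<close>; that is where the equality of laws enters.\<close>
  define D where "D k = (\<integral>\<omega>. (V' \<omega> - clip (real k) (V' \<omega>))\<^sup>2 \<partial>M)" for k
  have "D \<longlonglongrightarrow> (\<integral>\<omega>. 0 \<partial>M)"
    unfolding D_def
  proof (rule integral_dominated_convergence[where w = "\<lambda>\<omega>. (V' \<omega>)\<^sup>2"])
    show "AE \<omega> in M. norm ((V' \<omega> - clip (real k) (V' \<omega>))\<^sup>2) \<le> (V' \<omega>)\<^sup>2" for k
      by (intro AE_I2) (simp add: abs_clip_le(2) flip: abs_le_square_iff)
    show "AE \<omega> in M. (\<lambda>k. (V' \<omega> - clip (real k) (V' \<omega>))\<^sup>2) \<longlonglongrightarrow> 0"
    proof (intro AE_I2 tendsto_eventually)
      fix \<omega>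
      obtain K where "\<bar>V' \<omega>\<bar> \<le> real K" using real_arch_simple by blast
      then show "\<forall>\<^sub>F k in sequentially. (V' \<omega> - clip (real k) (V' \<omega>))\<^sup>2 = 0"
        by (intro eventually_sequentiallyI[of K]) (simp add: abs_clip_le(3))
    qed
  qed (use int' in auto)
  then have D: "D \<longlonglongrightarrow> 0" by simp
  \<comment> \<open>The weight in \<bar>x y\<bar> \<le> (t x^2 + y^2 / t) / 2, applied with y the
    truncation error. It makes the first contribution at most e / 2 whatever k is; then k is chosen
    so that D k / t < e. Adding 1 to C only avoids division by zero.\<close>
  define t where "t = e / (C + 1)"
  have t: "t > 0" "t * C \<le> e" using C e by (auto simp: t_def field_simps)
  obtain k where k: "D k < t * e" using order_tendstoD(2)[OF D, of "t * e"] t e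
    by (auto simp: eventually_sequentially)
  have err: "\<bar>(\<integral>\<omega>. W \<omega> * R \<omega> \<partial>M) - (\<integral>\<omega>. W \<omega> * clip (real k) (R \<omega>) \<partial>M)\<bar> \<le> e"
    if [measurable]: "W \<in> borel_measurable M" "R \<in> borel_measurable M"
      and W: "integrable M (\<lambda>\<omega>. (W \<omega>)\<^sup>2)" "(\<integral>\<omega>. (W \<omega>)\<^sup>2 \<partial>M) \<le> C"
      and R: "distr M borel R = distr M borel V'" for W R
  proof -
    have "integrable (distr M borel V') (\<lambda>x. x\<^sup>2)" using int' by (subst integrable_distr_eq) auto
    then have R2: "integrable M (\<lambda>\<omega>. (R \<omega>)\<^sup>2)"
      unfolding R[symmetric] by (subst (asm) integrable_distr_eq) auto
    have "D k = (\<integral>x. (x - clip (real k) x)\<^sup>2 \<partial>distr M borel V')"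
      unfolding D_def by (subst integral_distr) auto
    then have DR: "D k = (\<integral>\<omega>. (R \<omega> - clip (real k) (R \<omega>))\<^sup>2 \<partial>M)"
      unfolding R[symmetric] by (subst (asm) integral_distr) auto
    have i1: "integrable M (\<lambda>\<omega>. W \<omega> * R \<omega>)" by (rule integrable_mult_of_squares) (use W R2 in auto)
    have i2: "integrable M (\<lambda>\<omega>. (clip (real k) (R \<omega>))\<^sup>2)"
      by (rule integrable_const_bound[of _ "(real k)\<^sup>2"])
        (use abs_clip_le(1)[of "real k"] in \<open>auto simp flip: abs_le_square_iff\<close>)
    have i3: "integrable M (\<lambda>\<omega>. W \<omega> * clip (real k) (R \<omega>))"
      by (rule integrable_mult_of_squares) (use W i2 in auto)
    have i4: "integrable M (\<lambda>\<omega>. (R \<omega> - clip (real k) (R \<omega>))\<^sup>2)"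
      by (rule Bochner_Integration.integrable_bound[OF R2])
        (use abs_clip_le(2)[of "real k"] in \<open>auto simp flip: abs_le_square_iff\<close>)
    have "\<bar>x * y\<bar> \<le> (t * x\<^sup>2 + y\<^sup>2 / t) / 2" for x y :: real
    proof -
      have "t * (t * x\<^sup>2 + y\<^sup>2 / t) = (t * \<bar>x\<bar>)\<^sup>2 + \<bar>y\<bar>\<^sup>2"
        using t(1) by (simp add: power_mult_distrib power2_eq_square field_simps)
      then have "t * (2 * (\<bar>x\<bar> * \<bar>y\<bar>)) \<le> t * (t * x\<^sup>2 + y\<^sup>2 / t)"
        using sum_squares_bound[of "t * \<bar>x\<bar>" "\<bar>y\<bar>"] by (simp add: algebra_simps)
      then show ?thesis using t(1) by (simp add: abs_mult)
    qed
    then have le: "\<bar>W \<omega> * R \<omega> - W \<omega> * clip (real k) (R \<omega>)\<bar>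
        \<le> (t * (W \<omega>)\<^sup>2 + (R \<omega> - clip (real k) (R \<omega>))\<^sup>2 / t) / 2" for \<omega>
      unfolding right_diff_distrib[symmetric] .
    have "\<bar>(\<integral>\<omega>. W \<omega> * R \<omega> \<partial>M) - (\<integral>\<omega>. W \<omega> * clip (real k) (R \<omega>) \<partial>M)\<bar>
        = \<bar>\<integral>\<omega>. W \<omega> * R \<omega> - W \<omega> * clip (real k) (R \<omega>) \<partial>M\<bar>"
      using i1 i3 by simp
    also have "\<dots> \<le> (\<integral>\<omega>. \<bar>W \<omega> * R \<omega> - W \<omega> * clip (real k) (R \<omega>)\<bar> \<partial>M)" by (rule integral_abs_bound)
    also have "\<dots> \<le> (\<integral>\<omega>. (t * (W \<omega>)\<^sup>2 + (R \<omega> - clip (real k) (R \<omega>))\<^sup>2 / t) / 2 \<partial>M)"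
      by (rule integral_mono) (use i1 i3 i4 W le in auto)
    also have "\<dots> = (t * (\<integral>\<omega>. (W \<omega>)\<^sup>2 \<partial>M) + D k / t) / 2"
      using i4 W by (simp add: DR)
    also have "\<dots> \<le> (t * C + e) / 2"
      using W(2) k t(1) by (intro divide_right_mono add_mono mult_left_mono) (auto simp: field_simps)
    finally show ?thesis using t(2) by simp
  qed
  show "\<exists>b l'. b \<longlonglongrightarrow> l' \<and> (\<forall>n. \<bar>(\<integral>\<omega>. U n \<omega> * V n \<omega> \<partial>M) - b n\<bar> \<le> e) \<and> \<bar>(\<integral>\<omega>. U' \<omega> * V' \<omega> \<partial>M) - l'\<bar> \<le> e"
  proof (intro exI conjI allI)
    have le: "(U n \<omega> * clip (real k) (V n \<omega>))\<^sup>2 \<le> (real k)\<^sup>2 * (U n \<omega>)\<^sup>2" for n \<omega>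
    proof -
      have "(clip (real k) (V n \<omega>))\<^sup>2 \<le> (real k)\<^sup>2"
        using abs_clip_le(1)[of "real k" "V n \<omega>"] by (simp flip: abs_le_square_iff)
      then show ?thesis unfolding power_mult_distrib by (subst mult.commute) (rule mult_right_mono, auto)
    qed
    have i: "integrable M (\<lambda>\<omega>. (real k)\<^sup>2 * (U n \<omega>)\<^sup>2)" for n using int by simp
    have i': "integrable M (\<lambda>\<omega>. (U n \<omega> * clip (real k) (V n \<omega>))\<^sup>2)" for n
      by (rule Bochner_Integration.integrable_bound[OF i[of n]]) (use le in auto)
    \<comment> \<open>With one factor bounded by k, the products are again bounded in L2, and the
      result for a single sequence applies.\<close>
    show "(\<lambda>n. \<integral>\<omega>. U n \<omega> * clip (real k) (V n \<omega>) \<partial>M) \<longlonglongrightarrow> (\<integral>\<omega>. U' \<omega> * clip (real k) (V' \<omega>) \<partial>M)"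
    proof (rule tendsto_integral_L2_bounded[OF _ _ i', where C = "(real k)\<^sup>2 * C"])
      fix n
      have "(\<integral>\<omega>. (U n \<omega> * clip (real k) (V n \<omega>))\<^sup>2 \<partial>M) \<le> (\<integral>\<omega>. (real k)\<^sup>2 * (U n \<omega>)\<^sup>2 \<partial>M)"
        by (rule integral_mono[OF i' i le])
      also have "\<dots> \<le> (real k)\<^sup>2 * C" using bd by (simp add: mult_left_mono)
      finally show "(\<integral>\<omega>. (U n \<omega> * clip (real k) (V n \<omega>))\<^sup>2 \<partial>M) \<le> (real k)\<^sup>2 * C" .
    next
      show "AE \<omega> in M. (\<lambda>n. U n \<omega> * clip (real k) (V n \<omega>)) \<longlonglongrightarrow> U' \<omega> * clip (real k) (V' \<omega>)"
        using lim by eventually_elim (intro tendsto_mult tendsto_clip)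
    qed measurable
  qed (use assms U' in \<open>auto intro!: err\<close>)
qed

section \<open>Attainment of the maximum\<close>

lemma bform_eq_sum: "bform S x y = (\<Sum>i\<in>UNIV. \<Sum>j\<in>UNIV. S $ i $ j * (x $ i * y $ j))"
  unfolding bform_def inner_vec_def matrix_vector_mult_def
  by (simp add: sum_distrib_left mult_ac)

lemma abs_bform_le: "\<bar>bform S x y\<bar> \<le> (\<Sum>i\<in>UNIV. \<Sum>j\<in>UNIV. \<bar>S $ i $ j\<bar>) * (norm x * norm y)"
proof -
  have "\<bar>S $ i $ j * (x $ i * y $ j)\<bar> \<le> \<bar>S $ i $ j\<bar> * (norm x * norm y)" for i j
    unfolding abs_mult by (intro mult_left_mono mult_mono component_le_norm_cart) auto
  then have "\<bar>bform S x y\<bar> \<le> (\<Sum>i\<in>UNIV. \<Sum>j\<in>UNIV. \<bar>S $ i $ j\<bar> * (norm x * norm y))"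
    unfolding bform_eq_sum by (intro order_trans[OF sum_abs] sum_mono)
  then show ?thesis by (simp add: sum_distrib_right)
qed

lemma norm_square_eq_sum: "(norm (x :: real^'n))\<^sup>2 = (\<Sum>i\<in>UNIV. (x $ i)\<^sup>2)"
  by (simp add: norm_vec_def L2_set_def sum_nonneg)

lemma borel_measurable_bform[measurable]:
  assumes [measurable]: "f \<in> borel_measurable M" "g \<in> borel_measurable M"
  shows "(\<lambda>\<omega>. bform S (f \<omega>) (g \<omega>)) \<in> borel_measurable M"
  unfolding bform_eq_sum by measurable

lemma integrable_bform:
  assumes [measurable]: "f \<in> borel_measurable M" "g \<in> borel_measurable M"
    and sq: "integrable M (\<lambda>\<omega>. (norm (f \<omega>))\<^sup>2)" "integrable M (\<lambda>\<omega>. (norm (g \<omega>))\<^sup>2)"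
  shows "integrable M (\<lambda>\<omega>. bform S (f \<omega>) (g \<omega>))"
proof -
  have "integrable M (\<lambda>\<omega>. (\<Sum>i\<in>UNIV. \<Sum>j\<in>UNIV. \<bar>S $ i $ j\<bar>) * (norm (f \<omega>) * norm (g \<omega>)))"
    by (intro integrable_mult_right integrable_mult_of_squares) (use sq in auto)
  then show ?thesis
    by (rule Bochner_Integration.integrable_bound)
      (auto intro!: order_trans[OF abs_bform_le])
qed

text \<open>Integrals of bounded continuous functions pass to the limit and are constant along the
  sequence, so they agree for \<open>V'\<close> and \<open>V 0\<close>. The comparison through
  continuous functions, with weight 1, then identifies the two laws.\<close>

lemma distr_limit_same_law:
  fixes V :: "nat \<Rightarrow> 'a \<Rightarrow> 'b::metric_space"
  assumes "prob_space M" and [measurable]: "\<And>n. V n \<in> borel_measurable M" "V' \<in> borel_measurable M"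
    and law: "\<And>n. distr M borel (V n) = \<nu>" and lim: "AE \<omega> in M. (\<lambda>n. V n \<omega>) \<longlonglongrightarrow> V' \<omega>"
  shows "distr M borel V' = \<nu>"
proof -
  interpret prob_space M by fact
  have "distr M borel V' = distr M borel (V 0)"
  proof (rule measure_eqI)
    fix B :: "'b set" assume "B \<in> sets (distr M borel V')"
    then have B[measurable]: "B \<in> sets borel" by simp
    have "(\<integral>\<omega>. indicator B (V' \<omega>) * 1 \<partial>M) = (\<integral>\<omega>. indicator B (V 0 \<omega>) * (1::real) \<partial>M)"
    proof (rule indicator_integral_eqI_continuous[OF _ _ _ _ _ B])
      fix \<phi> :: "'b \<Rightarrow> real" assume \<phi>: "continuous_on UNIV \<phi>" "\<And>x. 0 \<le> \<phi> x \<and> \<phi> x \<le> 1"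
      have [measurable]: "\<phi> \<in> borel_measurable borel" using \<phi>(1) by (rule borel_measurable_continuous_onI)
      have "(\<lambda>n. \<integral>\<omega>. \<phi> (V n \<omega>) \<partial>M) \<longlonglongrightarrow> (\<integral>\<omega>. \<phi> (V' \<omega>) \<partial>M)"
      proof (rule integral_dominated_convergence[where w = "\<lambda>_. 1"])
        show "AE \<omega> in M. (\<lambda>n. \<phi> (V n \<omega>)) \<longlonglongrightarrow> \<phi> (V' \<omega>)"
          using lim by eventually_elim (use \<phi>(1) in \<open>auto intro: continuous_on_tendsto_compose\<close>)
      qed (use \<phi>(2) in auto)
      moreover have "(\<integral>\<omega>. \<phi> (V n \<omega>) \<partial>M) = (\<integral>x. \<phi> x \<partial>\<nu>)" for n
        unfolding law[of n, symmetric] by (subst integral_distr) auto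
      ultimately have "(\<integral>\<omega>. \<phi> (V' \<omega>) \<partial>M) = (\<integral>x. \<phi> x \<partial>\<nu>)" by (simp add: LIMSEQ_const_iff)
      also have "\<dots> = (\<integral>\<omega>. \<phi> (V 0 \<omega>) \<partial>M)"
        unfolding law[of 0, symmetric] by (subst integral_distr) auto
      finally show "(\<integral>\<omega>. \<phi> (V' \<omega>) * 1 \<partial>M) = (\<integral>\<omega>. \<phi> (V 0 \<omega>) * 1 \<partial>M)" by simp
    qed auto
    moreover have "(\<integral>\<omega>. indicator B (W \<omega>) * (1::real) \<partial>M) = measure (distr M borel W) B"
      if [measurable]: "W \<in> borel_measurable M" for W
    proof -
      have "(\<integral>\<omega>. indicator B (W \<omega>) * (1::real) \<partial>M) = (\<integral>\<omega>. indicator (W -` B \<inter> space M) \<omega> \<partial>M)"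
        by (rule Bochner_Integration.integral_cong) (auto simp: indicator_def)
      then show ?thesis by (simp add: measure_distr)
    qed
    ultimately have "measure (distr M borel V') B = measure (distr M borel (V 0)) B" by simp
    then show "emeasure (distr M borel V') B = emeasure (distr M borel (V 0)) B"
      by (simp add: finite_measure.emeasure_eq_measure[OF finite_measure_distr])
  qed simp
  then show ?thesis using law by simp
qed

text \<open>Functions of x can be taken out of the conditional expectation given x. Beyond
  indicators, this is needed for continuous test functions and for the unbounded coordinate
  functions.\<close>

lemma MGamma_integral_eq:
  fixes \<gamma> :: "((real^'n) \<times> (real^'n)) measure"
  assumes \<gamma>: "\<gamma> \<in> MGamma \<nu>" and [measurable]: "h \<in> borel_measurable borel"
    and int: "integrable \<gamma> (\<lambda>p. h (fst p) * snd p $ i)"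
  shows "(\<integral>p. h (fst p) * snd p $ i \<partial>\<gamma>) = (\<integral>p. h (fst p) * fst p $ i \<partial>\<gamma>)"
proof -
  have "prob_space \<gamma>" and [measurable_cong]: "sets \<gamma> = sets borel"
    and AE: "AE p in \<gamma>. real_cond_exp \<gamma> (vimage_algebra (space \<gamma>) fst borel) (\<lambda>p. snd p $ i) p = fst p $ i"
    using \<gamma> by (auto simp: MGamma_def)
  let ?F = "vimage_algebra (space \<gamma>) fst borel"
  interpret finite_measure_subalgebra \<gamma> ?F
    by (rule finite_measure_subalgebra_vimage_algebra) (use \<open>prob_space \<gamma>\<close> in measurable)
  have XF[measurable]: "fst \<in> borel_measurable ?F" by (rule measurable_vimage_algebra1) simp
  have "(\<integral>p. h (fst p) * snd p $ i \<partial>\<gamma>) = (\<integral>p. h (fst p) * real_cond_exp \<gamma> ?F (\<lambda>p. snd p $ i) p \<partial>\<gamma>)"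
    by (rule real_cond_exp_intg(2)[symmetric, OF int]) measurable
  also have "\<dots> = (\<integral>p. h (fst p) * fst p $ i \<partial>\<gamma>)"
    by (rule integral_cong_AE) (use AE in auto)
  finally show ?thesis .
qed

text \<open>Conditional expectation contracts L2: coordinatewise, the martingale property makes y -
  x orthogonal to x, so the integral of its square is the difference of the second moments. The
  bounds depend on \<nu> alone, hence are uniform over all couplings.\<close>

lemma MGamma_second_moment_le:
  fixes \<gamma> :: "((real^'n) \<times> (real^'n)) measure"
  assumes \<gamma>: "\<gamma> \<in> MGamma \<nu>"
  shows "(\<integral>p. (norm (fst p))\<^sup>2 \<partial>\<gamma>) \<le> (\<integral>y. (norm y)\<^sup>2 \<partial>\<nu>)"
    and "(\<integral>p. (norm (snd p))\<^sup>2 \<partial>\<gamma>) = (\<integral>y. (norm y)\<^sup>2 \<partial>\<nu>)"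
proof -
  have [measurable_cong]: "sets \<gamma> = sets borel"
    and int: "integrable \<gamma> (\<lambda>p. (norm (fst p))\<^sup>2)" "integrable \<gamma> (\<lambda>p. (norm (snd p))\<^sup>2)"
    and \<nu>: "distr \<gamma> borel snd = \<nu>"
    using \<gamma> by (auto simp: MGamma_def)
  show eq: "(\<integral>p. (norm (snd p))\<^sup>2 \<partial>\<gamma>) = (\<integral>y. (norm y)\<^sup>2 \<partial>\<nu>)"
    unfolding \<nu>[symmetric] by (subst integral_distr) auto
  have ix: "integrable \<gamma> (\<lambda>p. (fst p $ i)\<^sup>2)" and iy: "integrable \<gamma> (\<lambda>p. (snd p $ i)\<^sup>2)" for i
    using int by (auto intro!: integrable_component_square)
  have "(\<integral>p. (fst p $ i)\<^sup>2 \<partial>\<gamma>) \<le> (\<integral>p. (snd p $ i)\<^sup>2 \<partial>\<gamma>)" for i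
  proof -
    have ixy: "integrable \<gamma> (\<lambda>p. fst p $ i * snd p $ i)"
      by (rule integrable_mult_of_squares) (use ix iy in auto)
    have "(\<integral>p. fst p $ i * snd p $ i \<partial>\<gamma>) = (\<integral>p. fst p $ i * fst p $ i \<partial>\<gamma>)"
      by (rule MGamma_integral_eq[where h = "\<lambda>v. v $ i", OF \<gamma> _ ixy]) measurable
    then have xy: "(\<integral>p. fst p $ i * snd p $ i \<partial>\<gamma>) = (\<integral>p. (fst p $ i)\<^sup>2 \<partial>\<gamma>)"
      by (simp add: power2_eq_square)
    have "0 \<le> (\<integral>p. (snd p $ i - fst p $ i)\<^sup>2 \<partial>\<gamma>)" by simp
    also have "\<dots> = (\<integral>p. (snd p $ i)\<^sup>2 - 2 * (fst p $ i * snd p $ i) + (fst p $ i)\<^sup>2 \<partial>\<gamma>)"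
      by (simp add: power2_diff algebra_simps)
    also have "\<dots> = (\<integral>p. (snd p $ i)\<^sup>2 \<partial>\<gamma>) - (\<integral>p. (fst p $ i)\<^sup>2 \<partial>\<gamma>)"
      using ix iy ixy xy by simp
    finally show ?thesis by simp
  qed
  then have "(\<Sum>i\<in>UNIV. \<integral>p. (fst p $ i)\<^sup>2 \<partial>\<gamma>) \<le> (\<Sum>i\<in>UNIV. \<integral>p. (snd p $ i)\<^sup>2 \<partial>\<gamma>)"
    by (intro sum_mono)
  then have "(\<integral>p. (norm (fst p))\<^sup>2 \<partial>\<gamma>) \<le> (\<integral>p. (norm (snd p))\<^sup>2 \<partial>\<gamma>)"
    unfolding norm_square_eq_sum using ix iy by simp
  then show "(\<integral>p. (norm (fst p))\<^sup>2 \<partial>\<gamma>) \<le> (\<integral>y. (norm y)\<^sup>2 \<partial>\<nu>)" using eq by simp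
qed

lemma MGamma_attains_max:
  fixes \<nu> :: "(real^'n) measure" and S :: "real^'n^'n"
  assumes "MGamma \<nu> \<noteq> {}"
  shows "\<exists>\<gamma>\<in>MGamma \<nu>. \<forall>\<gamma>'\<in>MGamma \<nu>.
    (\<integral>p. bform S (fst p) (snd p) \<partial>\<gamma>') \<le> (\<integral>p. bform S (fst p) (snd p) \<partial>\<gamma>)"
proof -
  define J where "J \<gamma> = (\<integral>p. bform S (fst p) (snd p) \<partial>\<gamma>)" for \<gamma> :: "((real^'n) \<times> (real^'n)) measure"
  define c where "c = (\<integral>y. (norm y)\<^sup>2 \<partial>\<nu>)"
  define K where "K = (\<Sum>i\<in>UNIV. \<Sum>j\<in>UNIV. \<bar>S $ i $ j\<bar>)"
  have K: "K \<ge> 0" unfolding K_def by (intro sum_nonneg) auto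
  have bdd: "J \<gamma> \<le> K * (2 * c)" if \<gamma>: "\<gamma> \<in> MGamma \<nu>" for \<gamma>
  proof -
    have [measurable_cong]: "sets \<gamma> = sets borel"
      and int: "integrable \<gamma> (\<lambda>p. (norm (fst p))\<^sup>2)" "integrable \<gamma> (\<lambda>p. (norm (snd p))\<^sup>2)"
      using \<gamma> by (auto simp: MGamma_def)
    have "J \<gamma> \<le> (\<integral>p. K * ((norm (fst p))\<^sup>2 + (norm (snd p))\<^sup>2) \<partial>\<gamma>)"
      unfolding J_def
    proof (rule integral_mono)
      show "bform S (fst p) (snd p) \<le> K * ((norm (fst p))\<^sup>2 + (norm (snd p))\<^sup>2)" for p
      proof -
        have "norm (fst p) * norm (snd p) \<le> (norm (fst p))\<^sup>2 + (norm (snd p))\<^sup>2"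
          using sum_squares_bound[of "norm (fst p)" "norm (snd p)"]
            mult_nonneg_nonneg[OF norm_ge_zero[of "fst p"] norm_ge_zero[of "snd p"]] by linarith
        then have "K * (norm (fst p) * norm (snd p)) \<le> K * ((norm (fst p))\<^sup>2 + (norm (snd p))\<^sup>2)"
          using K by (intro mult_left_mono)
        then show ?thesis using abs_bform_le[of S "fst p" "snd p"] unfolding K_def[symmetric] by linarith
      qed
    qed (use int in \<open>auto intro!: integrable_bform\<close>)
    also have "\<dots> = K * ((\<integral>p. (norm (fst p))\<^sup>2 \<partial>\<gamma>) + (\<integral>p. (norm (snd p))\<^sup>2 \<partial>\<gamma>))"
      using int by simp
    also have "\<dots> \<le> K * (2 * c)"
      using MGamma_second_moment_le[OF \<gamma>] K by (intro mult_left_mono) (auto simp: c_def)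
    finally show ?thesis .
  qed
  define s where "s = (SUP \<gamma>\<in>MGamma \<nu>. J \<gamma>)"
  have bA: "bdd_above (J ` MGamma \<nu>)" using bdd by (auto intro!: bdd_aboveI)
  have Js: "J \<gamma> \<le> s" if "\<gamma> \<in> MGamma \<nu>" for \<gamma> unfolding s_def using that bA by (rule cSUP_upper)
  have "\<exists>\<gamma>\<in>MGamma \<nu>. s - 1 / real (Suc n) < J \<gamma>" for n
    using less_cSUP_iff[OF assms bA, of "s - 1 / real (Suc n)"] unfolding s_def by simp
  then obtain G where G: "\<And>n. G n \<in> MGamma \<nu>" and GJ: "\<And>n. s - 1 / real (Suc n) < J (G n)" by metis
  have "(\<lambda>n. J (G n)) \<longlonglongrightarrow> s"
  proof (rule tendsto_sandwich[OF _ _ _ tendsto_const])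
    show "(\<lambda>n. s - 1 / real (Suc n)) \<longlonglongrightarrow> s"
      using tendsto_diff[OF tendsto_const LIMSEQ_Suc[OF lim_1_over_n], of s] by simp
  qed (auto intro!: always_eventually less_imp_le[OF GJ] Js G simp del: of_nat_Suc)
  have prob: "prob_space (G n)" and sG: "sets (G n) = sets borel"
    and intG: "integrable (G n) (\<lambda>p. (norm (fst p))\<^sup>2)" "integrable (G n) (\<lambda>p. (norm (snd p))\<^sup>2)"
    and \<nu>: "distr (G n) borel snd = \<nu>" for n
    using G[of n] by (auto simp: MGamma_def)
  note [measurable_cong] = sG
  have bd: "(\<integral>\<^sup>+ z. ennreal ((norm z)\<^sup>2) \<partial>G n) \<le> ennreal (2 * c)" for n
  proof -
    have nz: "(norm z)\<^sup>2 = (norm (fst z))\<^sup>2 + (norm (snd z))\<^sup>2" for z :: "(real^'n) \<times> (real^'n)"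
      by (simp add: norm_prod_def)
    have "(\<integral>\<^sup>+ z. ennreal ((norm z)\<^sup>2) \<partial>G n) = ennreal (\<integral>z. (norm z)\<^sup>2 \<partial>G n)"
      by (rule nn_integral_eq_integral) (use intG[of n] in \<open>auto simp: nz\<close>)
    also have "(\<integral>z. (norm z)\<^sup>2 \<partial>G n) \<le> 2 * c"
      unfolding nz using intG[of n] MGamma_second_moment_le[OF G[of n]] by (simp add: c_def)
    finally show ?thesis by (simp add: ennreal_leI)
  qed
  obtain \<Omega> :: "real measure" and r :: "nat \<Rightarrow> nat" and Z Z' where r: "strict_mono r" and \<Omega>: "prob_space \<Omega>"
    and Zm[measurable]: "\<And>n. Z n \<in> borel_measurable \<Omega>" "Z' \<in> borel_measurable \<Omega>"
    and dZ: "\<And>n. distr \<Omega> borel (Z n) = G (r n)" and Zlim: "AE \<omega> in \<Omega>. (\<lambda>n. Z n \<omega>) \<longlonglongrightarrow> Z' \<omega>"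
    by (rule subsequence_converging_AE[of G, OF prob sG bd]) blast
  interpret prob_space \<Omega> by fact
  define X Y X' Y' where "X n \<omega> = fst (Z n \<omega>)" and "Y n \<omega> = snd (Z n \<omega>)"
    and "X' \<omega> = fst (Z' \<omega>)" and "Y' \<omega> = snd (Z' \<omega>)" for n \<omega>
  note XY_def = X_def Y_def X'_def Y'_def
  have [measurable]: "X n \<in> borel_measurable \<Omega>" "Y n \<in> borel_measurable \<Omega>"
    "X' \<in> borel_measurable \<Omega>" "Y' \<in> borel_measurable \<Omega>" for n
    unfolding XY_def[abs_def] by measurable
  have limX: "AE \<omega> in \<Omega>. (\<lambda>n. X n \<omega>) \<longlonglongrightarrow> X' \<omega>" and limY: "AE \<omega> in \<Omega>. (\<lambda>n. Y n \<omega>) \<longlonglongrightarrow> Y' \<omega>"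
    using Zlim unfolding XY_def by (auto elim!: eventually_mono intro: tendsto_fst tendsto_snd)
  have limXi: "AE \<omega> in \<Omega>. (\<lambda>n. X n \<omega> $ i) \<longlonglongrightarrow> X' \<omega> $ i"
    and limYi: "AE \<omega> in \<Omega>. (\<lambda>n. Y n \<omega> $ i) \<longlonglongrightarrow> Y' \<omega> $ i" for i
    by (rule eventually_mono[OF limX], erule tendsto_vec_nth)
      (rule eventually_mono[OF limY], erule tendsto_vec_nth)
  have transfer: "integral\<^sup>L (G (r n)) f = (\<integral>\<omega>. f (X n \<omega>, Y n \<omega>) \<partial>\<Omega>)"
    if [measurable]: "f \<in> borel_measurable borel" for f :: "_ \<Rightarrow> real" and n
    unfolding dZ[of n, symmetric] XY_def by (subst integral_distr) auto
  have transfer_int: "integrable (G (r n)) f \<longleftrightarrow> integrable \<Omega> (\<lambda>\<omega>. f (X n \<omega>, Y n \<omega>))"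
    if [measurable]: "f \<in> borel_measurable borel" for f :: "_ \<Rightarrow> real" and n
    unfolding dZ[of n, symmetric] XY_def by (subst integrable_distr_eq) auto
  have X2: "integrable \<Omega> (\<lambda>\<omega>. (norm (X n \<omega>))\<^sup>2)" and Y2: "integrable \<Omega> (\<lambda>\<omega>. (norm (Y n \<omega>))\<^sup>2)" for n
    using intG[of "r n"] by (simp_all add: transfer_int)
  have X2c: "(\<integral>\<omega>. (norm (X n \<omega>))\<^sup>2 \<partial>\<Omega>) \<le> c" and Y2c: "(\<integral>\<omega>. (norm (Y n \<omega>))\<^sup>2 \<partial>\<Omega>) \<le> c" for n
    using MGamma_second_moment_le[OF G[of "r n"]] by (simp_all add: transfer c_def)
  have Xi2: "integrable \<Omega> (\<lambda>\<omega>. (X n \<omega> $ i)\<^sup>2)" and Yi2: "integrable \<Omega> (\<lambda>\<omega>. (Y n \<omega> $ i)\<^sup>2)" for n i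
    using X2 Y2 by (auto intro!: integrable_component_square)
  have Xi2c: "(\<integral>\<omega>. (X n \<omega> $ i)\<^sup>2 \<partial>\<Omega>) \<le> c" for n i
    by (rule order_trans[OF integral_mono[OF Xi2 X2 component_square_le] X2c])
  have Yi2c: "(\<integral>\<omega>. (Y n \<omega> $ i)\<^sup>2 \<partial>\<Omega>) \<le> c" for n i
    by (rule order_trans[OF integral_mono[OF Yi2 Y2 component_square_le] Y2c])
  have X'2: "integrable \<Omega> (\<lambda>\<omega>. (norm (X' \<omega>))\<^sup>2)" and Y'2: "integrable \<Omega> (\<lambda>\<omega>. (norm (Y' \<omega>))\<^sup>2)"
    using L2_bounded_limit(1)[OF _ _ X2 X2c limX] L2_bounded_limit(1)[OF _ _ Y2 Y2c limY] by simp_all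
  have lawY: "distr \<Omega> borel (Y n) = \<nu>" for n
  proof -
    have "distr \<Omega> borel (Y n) = distr (distr \<Omega> borel (Z n)) borel snd"
      by (subst distr_distr) (auto simp: comp_def Y_def[abs_def])
    then show ?thesis by (simp add: dZ \<nu>)
  qed
  have lawY': "distr \<Omega> borel Y' = \<nu>" by (rule distr_limit_same_law[OF \<Omega> _ _ lawY limY]) auto
  have lawYi: "distr \<Omega> borel (\<lambda>\<omega>. Y n \<omega> $ i) = distr \<Omega> borel (\<lambda>\<omega>. Y' \<omega> $ i)" for n i
  proof -
    have "distr \<Omega> borel (\<lambda>\<omega>. W \<omega> $ i) = distr (distr \<Omega> borel W) borel (\<lambda>v. v $ i)"
      if [measurable]: "W \<in> borel_measurable \<Omega>" for W :: "real \<Rightarrow> real^'n"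
      by (subst distr_distr) (auto simp: comp_def)
    then show ?thesis using lawY lawY' by simp
  qed
  have mart: "(\<integral>\<omega>. indicator B (X' \<omega>) * Y' \<omega> $ i \<partial>\<Omega>) = (\<integral>\<omega>. indicator B (X' \<omega>) * X' \<omega> $ i \<partial>\<Omega>)"
    if B: "B \<in> sets borel" for B i
  proof (rule indicator_integral_eqI_continuous[OF _ _ _ _ _ B])
    show "integrable \<Omega> (\<lambda>\<omega>. Y' \<omega> $ i)" "integrable \<Omega> (\<lambda>\<omega>. X' \<omega> $ i)"
      using X'2 Y'2 by (auto intro!: integrable_component)
    fix \<phi> :: "real^'n \<Rightarrow> real" assume \<phi>: "continuous_on UNIV \<phi>" "\<And>x. 0 \<le> \<phi> x \<and> \<phi> x \<le> 1"
    have [measurable]: "\<phi> \<in> borel_measurable borel" using \<phi>(1) by (rule borel_measurable_continuous_onI)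
    \<comment> \<open>Stated for general W because both sides of the martingale identity need it.
      Continuity of \<phi> preserves convergence, and its bound by 1 preserves the L2 bound.\<close>
    have "(\<lambda>n. \<integral>\<omega>. \<phi> (X n \<omega>) * W n \<omega> \<partial>\<Omega>) \<longlonglongrightarrow> (\<integral>\<omega>. \<phi> (X' \<omega>) * W' \<omega> \<partial>\<Omega>)"
      if [measurable]: "\<And>n. W n \<in> borel_measurable \<Omega>" "W' \<in> borel_measurable \<Omega>"
        and W: "\<And>n. integrable \<Omega> (\<lambda>\<omega>. (W n \<omega>)\<^sup>2)" "\<And>n. (\<integral>\<omega>. (W n \<omega>)\<^sup>2 \<partial>\<Omega>) \<le> c"
          "AE \<omega> in \<Omega>. (\<lambda>n. W n \<omega>) \<longlonglongrightarrow> W' \<omega>"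
      for W :: "nat \<Rightarrow> real \<Rightarrow> real" and W'
    proof -
      have le: "(\<phi> (X n \<omega>) * W n \<omega>)\<^sup>2 \<le> (W n \<omega>)\<^sup>2" for n \<omega>
        unfolding power_mult_distrib using \<phi>(2)[of "X n \<omega>"]
        by (intro mult_left_le_one_le) (auto intro: power_le_one)
      have i: "integrable \<Omega> (\<lambda>\<omega>. (\<phi> (X n \<omega>) * W n \<omega>)\<^sup>2)" for n
        by (rule Bochner_Integration.integrable_bound[OF W(1)[of n]]) (use le in auto)
      show ?thesis
      proof (rule tendsto_integral_L2_bounded[OF _ _ i, where C = c])
        show "(\<integral>\<omega>. (\<phi> (X n \<omega>) * W n \<omega>)\<^sup>2 \<partial>\<Omega>) \<le> c" for n
          by (rule order_trans[OF integral_mono[OF i W(1) le] W(2)])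
        show "AE \<omega> in \<Omega>. (\<lambda>n. \<phi> (X n \<omega>) * W n \<omega>) \<longlonglongrightarrow> \<phi> (X' \<omega>) * W' \<omega>"
          using W(3) limX
          by eventually_elim (use \<phi>(1) in \<open>auto intro!: tendsto_mult intro: continuous_on_tendsto_compose\<close>)
      qed measurable
    qed
    note l = this
    have "(\<lambda>n. \<integral>\<omega>. \<phi> (X n \<omega>) * Y n \<omega> $ i \<partial>\<Omega>) \<longlonglongrightarrow> (\<integral>\<omega>. \<phi> (X' \<omega>) * Y' \<omega> $ i \<partial>\<Omega>)"
      by (rule l[OF _ _ Yi2 Yi2c limYi]) measurable
    moreover have "(\<lambda>n. \<integral>\<omega>. \<phi> (X n \<omega>) * X n \<omega> $ i \<partial>\<Omega>) \<longlonglongrightarrow> (\<integral>\<omega>. \<phi> (X' \<omega>) * X' \<omega> $ i \<partial>\<Omega>)"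
      by (rule l[OF _ _ Xi2 Xi2c limXi]) measurable
    moreover have "(\<integral>\<omega>. \<phi> (X n \<omega>) * Y n \<omega> $ i \<partial>\<Omega>) = (\<integral>\<omega>. \<phi> (X n \<omega>) * X n \<omega> $ i \<partial>\<Omega>)" for n
    proof -
      have "integrable \<Omega> (\<lambda>\<omega>. Y n \<omega> $ i)" using Y2 by (auto intro!: integrable_component)
      then have "integrable \<Omega> (\<lambda>\<omega>. \<phi> (X n \<omega>) * Y n \<omega> $ i)"
        by (rule Bochner_Integration.integrable_bound)
          (use \<phi>(2) in \<open>auto simp: abs_mult intro!: mult_left_le_one_le\<close>)
      then have "integrable (G (r n)) (\<lambda>p. \<phi> (fst p) * snd p $ i)" by (simp add: transfer_int)
      from MGamma_integral_eq[OF G _ this] show ?thesis by (simp add: transfer)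
    qed
    ultimately show "(\<integral>\<omega>. \<phi> (X' \<omega>) * Y' \<omega> $ i \<partial>\<Omega>) = (\<integral>\<omega>. \<phi> (X' \<omega>) * X' \<omega> $ i \<partial>\<Omega>)"
      by (simp add: LIMSEQ_unique)
  qed auto
  define \<gamma> where "\<gamma> = distr \<Omega> borel (\<lambda>\<omega>. (X' \<omega>, Y' \<omega>))"
  have \<gamma>: "\<gamma> \<in> MGamma \<nu>"
    unfolding \<gamma>_def lawY'[symmetric]
    by (rule distr_Pair_in_MGamma[OF \<Omega>]) (use X'2 Y'2 mart in auto)
  have Jsum: "(\<integral>\<omega>. bform S (U \<omega>) (W \<omega>) \<partial>\<Omega>) = (\<Sum>i\<in>UNIV. \<Sum>j\<in>UNIV. S $ i $ j * (\<integral>\<omega>. U \<omega> $ i * W \<omega> $ j \<partial>\<Omega>))"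
    if [measurable]: "U \<in> borel_measurable \<Omega>" "W \<in> borel_measurable \<Omega>"
      and "integrable \<Omega> (\<lambda>\<omega>. (norm (U \<omega>))\<^sup>2)" "integrable \<Omega> (\<lambda>\<omega>. (norm (W \<omega>))\<^sup>2)" for U W
  proof -
    have "integrable \<Omega> (\<lambda>\<omega>. U \<omega> $ i * W \<omega> $ j)" for i j
      by (rule integrable_mult_of_squares) (use that in \<open>auto intro!: integrable_component_square\<close>)
    then show ?thesis unfolding bform_eq_sum by simp
  qed
  \<comment> \<open>Each entry of S contributes a product of a coordinate of \<open>X n\<close>,
    merely bounded in L2, and a coordinate of \<open>Y n\<close>, whose law does not depend on
    n.\<close>
  have "(\<lambda>n. \<integral>\<omega>. bform S (X n \<omega>) (Y n \<omega>) \<partial>\<Omega>) \<longlonglongrightarrow> (\<integral>\<omega>. bform S (X' \<omega>) (Y' \<omega>) \<partial>\<Omega>)"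
    using X2 Y2 X'2 Y'2
    by (simp add: Jsum, intro tendsto_sum tendsto_mult tendsto_const
        tendsto_integral_mult_same_law[OF _ _ _ _ Xi2 Xi2c _ lawYi limXi limYi])
      (auto intro!: integrable_component_square)
  moreover have "(\<integral>\<omega>. bform S (X' \<omega>) (Y' \<omega>) \<partial>\<Omega>) = J \<gamma>"
    unfolding J_def \<gamma>_def by (subst integral_distr) auto
  moreover have "(\<integral>\<omega>. bform S (X n \<omega>) (Y n \<omega>) \<partial>\<Omega>) = J (G (r n))" for n
    unfolding J_def by (simp add: transfer)
  ultimately have "(\<lambda>n. J (G (r n))) \<longlonglongrightarrow> J \<gamma>" by simp
  moreover have "(\<lambda>n. J (G (r n))) \<longlonglongrightarrow> s"
    using LIMSEQ_subseq_LIMSEQ[OF \<open>(\<lambda>n. J (G n)) \<longlonglongrightarrow> s\<close> r] by (simp add: comp_def)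
  ultimately have "J \<gamma> = s" by (rule LIMSEQ_unique)
  then have "J \<gamma>' \<le> J \<gamma>" if "\<gamma>' \<in> MGamma \<nu>" for \<gamma>' using Js[OF that] by simp
  then show ?thesis using \<gamma> unfolding J_def by blast
qed

section \<open>Transport of atomless measures\<close>

text \<open>The probability integral transform: without atoms the distribution function does not
  jump over any level, so it is uniformly distributed. Strict sublevel sets at levels inside (0, 1)
  are computed first, and the remaining cases follow by squeezing.\<close>

lemma (in real_distribution) cdf_uniform:
  assumes atomless: "\<And>x. measure M {x} = 0" and u: "0 \<le> u" "u \<le> 1"
  shows "measure M {x. cdf M x \<le> u} = u"
proof -
  interpret cdf_distribution M by standard
  have [measurable]: "cdf M \<in> borel_measurable M" by simp
  have less: "measure M {x. cdf M x < v} = v" if v: "0 < v" "v < 1" for v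
  proof -
    \<comment> \<open>The sublevel set is the open half-line below the quantile \<open>I v\<close>.
      Its mass is a left limit of values below v, and by absence of an atom it equals
      \<open>cdf M (I v)\<close>, which is at least v.\<close>
    have lt: "cdf M x < v \<longleftrightarrow> x < I v" for x using pseudoinverse[OF v, of x] by linarith
    then have "{x. cdf M x < v} = {..<I v}" by auto
    then have eq: "measure M {x. cdf M x < v} = measure M {..<I v}" by simp
    have "measure M {..<I v} \<le> v"
    proof (rule tendsto_upperbound[OF cdf_at_left])
      show "\<forall>\<^sub>F x in at_left (I v). cdf M x \<le> v"
        unfolding eventually_at_filter
        by (intro always_eventually) (auto dest: lt[THEN iffD2])
    qed simp
    moreover have "v \<le> cdf M (I v)" using pseudoinverse[OF v, of "I v"] by simp
    moreover have "cdf M (I v) = measure M {..<I v}"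
    proof -
      have "{..I v} = {..<I v} \<union> {I v}" by auto
      then have "measure M {..I v} = measure M {..<I v} + measure M {I v}"
        by (simp only:) (rule finite_measure_Union, auto)
      then show ?thesis using atomless by (simp add: cdf_def)
    qed
    ultimately show ?thesis using eq by linarith
  qed
  have upper: "measure M {x. cdf M x \<le> u} \<le> v" if "u < v" "v < 1" for v
  proof -
    have "measure M {x. cdf M x \<le> u} \<le> measure M {x. cdf M x < v}"
      using that by (intro finite_measure_mono) auto
    then show ?thesis using less[of v] that u by simp
  qed
  show ?thesis
  proof (cases "u = 1")
    case True
    then have "{x. cdf M x \<le> u} = space M" using cdf_bounded_prob by auto
    then show ?thesis using True prob_space by simp
  next
    case False
    then have "measure M {x. cdf M x \<le> u} \<le> u"
      using u upper by (intro dense_ge_bounded[of u 1]) auto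
    moreover have "u \<le> measure M {x. cdf M x \<le> u}"
    proof (cases "u = 0")
      case False
      then have "u = measure M {x. cdf M x < u}" using u \<open>u \<noteq> 1\<close> less[of u] by simp
      also have "\<dots> \<le> measure M {x. cdf M x \<le> u}" by (intro finite_measure_mono) auto
      finally show ?thesis .
    qed simp
    ultimately show ?thesis by simp
  qed
qed

text \<open>The distribution function of M produces a uniform variable, and the quantile function of
  N turns a uniform variable into one with law N.\<close>

lemma atomless_transport_real:
  assumes "real_distribution M" "real_distribution N" and atomless: "\<And>x. measure M {x} = 0"
  obtains \<tau> :: "real \<Rightarrow> real" where "\<tau> \<in> borel_measurable borel" "distr M borel \<tau> = N"
proof -
  interpret M: real_distribution M by fact
  interpret N: cdf_distribution N unfolding cdf_distribution_def by fact
  have [measurable]: "cdf M \<in> borel_measurable borel"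
    by (rule borel_measurable_mono) (auto intro!: monoI M.cdf_nondecreasing)
  \<comment> \<open>The quantile function is used only at levels strictly between 0 and 1. The value
    elsewhere is arbitrary, since by uniformity the levels 0 and 1 are attained with probability
    zero.\<close>
  define J where "J u = (if u \<in> {0<..<1} then N.I u else 0)" for u
  have [measurable]: "J \<in> borel_measurable borel"
    unfolding J_def by (rule measurable_restrict_space_iff[THEN iffD1, OF _ _ N.measurable_CI]) auto
  define \<tau> where "\<tau> x = J (cdf M x)" for x
  have m[measurable]: "\<tau> \<in> borel_measurable borel" unfolding \<tau>_def by measurable
  have unif: "measure M {x. cdf M x \<le> u} = u" if "0 \<le> u" "u \<le> 1" for u
    using M.cdf_uniform[OF atomless that] .
  have "AE x in M. 0 < cdf M x"
  proof -
    have "emeasure M {x. cdf M x \<le> 0} = 0" using unif[of 0] by (simp add: M.emeasure_eq_measure)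
    then show ?thesis by (intro AE_I[where N = "{x. cdf M x \<le> 0}"]) (auto simp: not_less)
  qed
  moreover have "AE x in M. cdf M x < 1"
  proof -
    have "1 \<le> measure M {x. cdf M x < 1}"
    proof (rule dense_le_bounded[of 0 1])
      fix u :: real assume u: "0 < u" "u < 1"
      have "u = measure M {x. cdf M x \<le> u}" using unif[of u] u by simp
      also have "\<dots> \<le> measure M {x. cdf M x < 1}" using u by (intro M.finite_measure_mono) auto
      finally show "u \<le> measure M {x. cdf M x < 1}" .
    qed simp
    then have "measure M {x. cdf M x < 1} = 1" using M.prob_le_1 by (simp add: antisym)
    then show ?thesis using M.AE_in_set_eq_1[of "{x. cdf M x < 1}"] by simp
  qed
  ultimately have AE: "AE x in M. cdf M x \<in> {0<..<1}" by eventually_elim auto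
  have "distr M borel \<tau> = N"
  proof (rule cdf_unique)
    show "real_distribution (distr M borel \<tau>)" by simp
    show "real_distribution N" by fact
    show "cdf (distr M borel \<tau>) = cdf N"
    proof
      fix x
      have "cdf (distr M borel \<tau>) x = measure M {w. \<tau> w \<le> x}"
        by (simp add: cdf_def measure_distr vimage_def)
      also have "\<dots> = measure M {w. cdf M w \<le> cdf N x}"
      proof (rule M.finite_measure_eq_AE)
        show "AE w in M. (w \<in> {w. \<tau> w \<le> x}) = (w \<in> {w. cdf M w \<le> cdf N x})"
          using AE
        proof eventually_elim
          case (elim w)
          then show ?case using N.pseudoinverse[of "cdf M w" x] by (simp add: \<tau>_def J_def)
        qed
      qed simp_all
      also have "\<dots> = cdf N x" by (rule unif) (auto simp: N.cdf_nonneg N.cdf_bounded_prob)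
      finally show "cdf (distr M borel \<tau>) x = cdf N x" .
    qed
  qed
  with m show thesis by (rule that)
qed

text \<open>Coding both spaces by reals reduces to the line. Injectivity of the code keeps the image
  of \<nu> atomless, and decoding with a Borel left inverse recovers P.\<close>

lemma atomless_transport:
  fixes \<nu> :: "'a::euclidean_space measure" and P :: "'b::euclidean_space measure"
  assumes "prob_space \<nu>" "sets \<nu> = sets borel" "prob_space P" "sets P = sets borel"
    and atomless: "\<And>x. emeasure \<nu> {x} = 0"
  obtains \<theta> :: "'a \<Rightarrow> 'b" where "\<theta> \<in> borel_measurable borel" "distr \<nu> borel \<theta> = P"
proof -
  interpret \<nu>: prob_space \<nu> by fact
  interpret P: prob_space P by fact
  note [measurable_cong] = assms(2) assms(4)
  obtain T :: "'a \<Rightarrow> real" and g where T[measurable]: "T \<in> borel_measurable borel" and gT: "\<And>v. g (T v) = v"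
    by (rule borel_coding) blast
  obtain T' :: "'b \<Rightarrow> real" and g' where T'[measurable]: "T' \<in> borel_measurable borel"
    and g'[measurable]: "g' \<in> borel_measurable borel" and gT': "\<And>v. g' (T' v) = v"
    by (rule borel_coding) blast
  have "measure (distr \<nu> borel T) {x} = 0" for x
  proof -
    have "T -` {x} \<inter> space \<nu> \<subseteq> {g x}" using gT by auto
    then have "emeasure \<nu> (T -` {x} \<inter> space \<nu>) \<le> emeasure \<nu> {g x}"
      by (rule emeasure_mono) (simp add: assms(2))
    then show ?thesis using atomless[of "g x"] by (simp add: measure_def emeasure_distr)
  qed
  then obtain \<tau> where \<tau>[measurable]: "\<tau> \<in> borel_measurable borel"
    and d: "distr (distr \<nu> borel T) borel \<tau> = distr P borel T'"
    using atomless_transport_real[of "distr \<nu> borel T" "distr P borel T'"] by auto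
  have "distr \<nu> borel (\<lambda>y. g' (\<tau> (T y))) = distr (distr (distr \<nu> borel T) borel \<tau>) borel g'"
    by (simp add: distr_distr comp_def)
  also have "\<dots> = P" unfolding d by (simp add: distr_distr comp_def gT' distr_id2 assms(4))
  finally have "distr \<nu> borel (\<lambda>y. g' (\<tau> (T y))) = P" .
  then show thesis by (rule that[rotated]) measurable
qed

lemma (in finite_measure) emeasure_countable_cells:
  assumes [measurable]: "Measurable.pred M Q" "f \<in> M \<rightarrow>\<^sub>M count_space UNIV"
  shows "emeasure M {x \<in> space M. Q x} = (\<Sum>n::nat. emeasure M {x \<in> space M. f x = n \<and> Q x})"
proof -
  have "(\<Sum>n. emeasure M {x \<in> space M. f x = n \<and> Q x}) = emeasure M (\<Union>n. {x \<in> space M. f x = n \<and> Q x})"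
    by (rule suminf_emeasure) (auto simp: disjoint_family_on_def)
  also have "(\<Union>n. {x \<in> space M. f x = n \<and> Q x}) = {x \<in> space M. Q x}" by auto
  finally show ?thesis by simp
qed

text \<open>Both measures are conditioned on a cell, and the conditional law of x is reached by
  transporting the conditioned \<nu>, which is still atomless. The marginal condition gives cells
  equal mass on both sides, so the countably many maps glue to one with the right joint law.\<close>

lemma cellwise_transport:
  fixes \<gamma> :: "('b::euclidean_space \<times> 'a::euclidean_space) measure" and \<nu> :: "'a measure" and l :: "'a \<Rightarrow> nat"
  assumes \<nu>: "prob_space \<nu>" "sets \<nu> = sets borel" and \<gamma>: "prob_space \<gamma>" "sets \<gamma> = sets borel"
    and marginal: "distr \<gamma> borel snd = \<nu>"
    and atomless: "\<And>x. emeasure \<nu> {x} = 0" and l[measurable]: "l \<in> borel \<rightarrow>\<^sub>M count_space UNIV"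
  obtains \<theta> :: "'a \<Rightarrow> 'b" where "\<theta> \<in> borel_measurable borel"
    "distr \<nu> (borel \<Otimes>\<^sub>M count_space UNIV) (\<lambda>y. (\<theta> y, l y)) =
     distr \<gamma> (borel \<Otimes>\<^sub>M count_space UNIV) (\<lambda>p. (fst p, l (snd p)))"
proof -
  interpret \<nu>: prob_space \<nu> by fact
  interpret \<gamma>: prob_space \<gamma> by fact
  note [measurable_cong] = \<nu>(2) \<gamma>(2)
  have [simp]: "space \<nu> = UNIV" "space \<gamma> = UNIV"
    using sets_eq_imp_space_eq[OF \<nu>(2)] sets_eq_imp_space_eq[OF \<gamma>(2)] by auto
  have cell: "emeasure \<nu> {y. l y = n} = emeasure \<gamma> {p. l (snd p) = n}" for n
    unfolding marginal[symmetric] by (subst emeasure_distr) (auto simp: vimage_def)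
  have "\<exists>\<theta>. \<theta> \<in> borel_measurable borel \<and> (\<forall>B\<in>sets borel.
      emeasure \<nu> {y. l y = n \<and> \<theta> y \<in> B} = emeasure \<gamma> {p. l (snd p) = n \<and> fst p \<in> B})" for n
  proof (cases "emeasure \<nu> {y. l y = n} = 0")
    case True
    \<comment> \<open>Conditioning on a null cell is impossible, but both sides vanish there and any
      map will do.\<close>
    have "emeasure \<nu> {y. l y = n \<and> 0 \<in> B} = 0" for B :: "'b set"
      using emeasure_mono[of "{y. l y = n \<and> 0 \<in> B}" "{y. l y = n}" \<nu>] True by auto
    moreover have "emeasure \<gamma> {p. l (snd p) = n \<and> fst p \<in> B} = 0" for B
      using emeasure_mono[of "{p. l (snd p) = n \<and> fst p \<in> B}" "{p. l (snd p) = n}" \<gamma>] True cell by auto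
    ultimately show ?thesis by (intro exI[of _ "\<lambda>_. 0"]) auto
  next
    case False
    let ?\<nu> = "uniform_measure \<nu> {y. l y = n}" and ?\<gamma> = "uniform_measure \<gamma> {p. l (snd p) = n}"
    have fin: "emeasure \<nu> {y. l y = n} < top" by (simp add: \<nu>.emeasure_eq_measure)
    have p1: "prob_space ?\<nu>" using False by (intro prob_space_uniform_measure) auto
    have p2: "prob_space ?\<gamma>" using False cell[of n] by (intro prob_space_uniform_measure) auto
    obtain \<theta> where \<theta>[measurable]: "\<theta> \<in> borel_measurable borel" and d: "distr ?\<nu> borel \<theta> = distr ?\<gamma> borel fst"
    proof (rule atomless_transport[OF p1])
      show "prob_space (distr ?\<gamma> borel (fst :: 'b \<times> 'a \<Rightarrow> 'b))" by (rule prob_space.prob_space_distr[OF p2]) simp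
      show "emeasure ?\<nu> {x} = 0" for x
      proof -
        have "emeasure \<nu> ({y. l y = n} \<inter> {x}) \<le> emeasure \<nu> {x}" by (rule emeasure_mono) auto
        then show ?thesis using atomless[of x] by (subst emeasure_uniform_measure) auto
      qed
    qed (auto simp: \<nu>(2))
    have "emeasure \<nu> {y. l y = n \<and> \<theta> y \<in> B} = emeasure \<gamma> {p. l (snd p) = n \<and> fst p \<in> B}"
      if B[measurable]: "B \<in> sets borel" for B
    proof -
      let ?c = "emeasure \<nu> {y. l y = n}"
      have "emeasure (distr ?\<nu> borel \<theta>) B = emeasure ?\<nu> {y. \<theta> y \<in> B}"
        by (subst emeasure_distr) (auto simp: vimage_def)
      also have "\<dots> = emeasure \<nu> ({y. l y = n} \<inter> {y. \<theta> y \<in> B}) / ?c"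
        by (rule emeasure_uniform_measure) measurable
      finally have 1: "emeasure (distr ?\<nu> borel \<theta>) B = emeasure \<nu> ({y. l y = n} \<inter> {y. \<theta> y \<in> B}) / ?c" .
      have "emeasure (distr ?\<gamma> borel fst) B = emeasure ?\<gamma> {p. fst p \<in> B}"
        by (subst emeasure_distr) (auto simp: vimage_def)
      also have "\<dots> = emeasure \<gamma> ({p. l (snd p) = n} \<inter> {p. fst p \<in> B}) / ?c"
        unfolding cell by (rule emeasure_uniform_measure) measurable
      finally have 2: "emeasure (distr ?\<gamma> borel fst) B = emeasure \<gamma> ({p. l (snd p) = n} \<inter> {p. fst p \<in> B}) / ?c" .
      \<comment> \<open>The common normalising factor is nonzero and finite, so it cancels even
        among extended reals.\<close>
      have c: "?c / ?c = 1" using False fin by (rule ennreal_divide_self)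
      have "x = y" if "x / ?c = y / ?c" for x y
      proof -
        have "z / ?c * ?c = z" for z unfolding ennreal_divide_times c by simp
        then show ?thesis using that by metis
      qed
      with 1 2 d show ?thesis by (simp add: Collect_conj_eq)
    qed
    with \<theta> show ?thesis by blast
  qed
  then have "\<exists>\<Theta>. \<forall>n. \<Theta> n \<in> borel_measurable borel \<and> (\<forall>B\<in>sets borel.
      emeasure \<nu> {y. l y = n \<and> \<Theta> n y \<in> B} = emeasure \<gamma> {p. l (snd p) = n \<and> fst p \<in> B})"
    by (intro choice allI)
  then obtain \<Theta> where \<Theta>[measurable]: "\<And>n. \<Theta> n \<in> borel_measurable borel"
    and eq: "\<And>n B. B \<in> sets borel \<Longrightarrow>
      emeasure \<nu> {y. l y = n \<and> \<Theta> n y \<in> B} = emeasure \<gamma> {p. l (snd p) = n \<and> fst p \<in> B}"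
    by blast
  define \<theta> where "\<theta> y = \<Theta> (l y) y" for y
  have \<theta>[measurable]: "\<theta> \<in> borel_measurable borel"
    unfolding \<theta>_def by (rule measurable_compose_countable[where g = l]) auto
  have "distr \<nu> (borel \<Otimes>\<^sub>M count_space UNIV) (\<lambda>y. (\<theta> y, l y)) =
     distr \<gamma> (borel \<Otimes>\<^sub>M count_space UNIV) (\<lambda>p. (fst p, l (snd p)))"
  proof (rule measure_eqI)
    fix A assume "A \<in> sets (distr \<nu> (borel \<Otimes>\<^sub>M count_space UNIV) (\<lambda>y. (\<theta> y, l y)))"
    then have A[measurable]: "A \<in> sets (borel \<Otimes>\<^sub>M count_space UNIV)" by simp
    have An: "{x. (x, n) \<in> A} \<in> sets borel" for n
      using measurable_sets[OF measurable_Pair2'[of n "count_space UNIV" borel] A] by (simp add: vimage_def)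
    have "emeasure (distr \<nu> (borel \<Otimes>\<^sub>M count_space UNIV) (\<lambda>y. (\<theta> y, l y))) A = emeasure \<nu> {y \<in> space \<nu>. (\<theta> y, l y) \<in> A}"
      by (subst emeasure_distr) (auto simp: vimage_def)
    also have "\<dots> = (\<Sum>n. emeasure \<nu> {y \<in> space \<nu>. l y = n \<and> (\<theta> y, l y) \<in> A})"
      by (rule \<nu>.emeasure_countable_cells) measurable
    also have "\<dots> = (\<Sum>n. emeasure \<gamma> {p \<in> space \<gamma>. l (snd p) = n \<and> (fst p, l (snd p)) \<in> A})"
    proof (rule suminf_cong)
      fix n
      have "{y \<in> space \<nu>. l y = n \<and> (\<theta> y, l y) \<in> A} = {y. l y = n \<and> \<Theta> n y \<in> {x. (x, n) \<in> A}}"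
        by (auto simp: \<theta>_def)
      moreover have "{p \<in> space \<gamma>. l (snd p) = n \<and> (fst p, l (snd p)) \<in> A} = {p. l (snd p) = n \<and> fst p \<in> {x. (x, n) \<in> A}}"
        by auto
      ultimately show "emeasure \<nu> {y \<in> space \<nu>. l y = n \<and> (\<theta> y, l y) \<in> A}
          = emeasure \<gamma> {p \<in> space \<gamma>. l (snd p) = n \<and> (fst p, l (snd p)) \<in> A}"
        using eq[OF An] by simp
    qed
    also have "\<dots> = emeasure \<gamma> {p \<in> space \<gamma>. (fst p, l (snd p)) \<in> A}"
      by (rule \<gamma>.emeasure_countable_cells[symmetric]) measurable
    also have "\<dots> = emeasure (distr \<gamma> (borel \<Otimes>\<^sub>M count_space UNIV) (\<lambda>p. (fst p, l (snd p)))) A"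
      by (subst emeasure_distr) (auto simp: vimage_def)
    finally show "emeasure (distr \<nu> (borel \<Otimes>\<^sub>M count_space UNIV) (\<lambda>y. (\<theta> y, l y))) A
        = emeasure (distr \<gamma> (borel \<Otimes>\<^sub>M count_space UNIV) (\<lambda>p. (fst p, l (snd p)))) A" .
  qed simp
  with \<theta> show thesis by (rule that)
qed

section \<open>Approximation by functions of the second marginal\<close>

lemma borel_measurable_vec_lambda:
  fixes f :: "'n::finite \<Rightarrow> 'a \<Rightarrow> real"
  assumes "\<And>i. f i \<in> borel_measurable M"
  shows "(\<lambda>\<omega>. \<chi> i. f i \<omega>) \<in> borel_measurable M"
  by (subst borel_measurable_euclidean_space) (use assms in \<open>auto simp: Basis_vec_def inner_axis\<close>)

text \<open>Measurability of D with respect to F makes the set where D exceeds c admissible as a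
  test set. There D - c is positive but has integral at most 0, so the set is null.\<close>

lemma (in prob_space) AE_le_of_set_integral_le:
  fixes D :: "'a \<Rightarrow> real"
  assumes F: "subalgebra M F" and DF: "D \<in> borel_measurable F" and D: "integrable M D"
    and le: "\<And>A. A \<in> sets F \<Longrightarrow> (\<integral>\<omega>. indicator A \<omega> * D \<omega> \<partial>M) \<le> c * measure M A"
  shows "AE \<omega> in M. D \<omega> \<le> c"
proof -
  define A where "A = {\<omega> \<in> space F. c < D \<omega>}"
  have AF: "A \<in> sets F" unfolding A_def using DF by measurable
  then have A[measurable]: "A \<in> sets M" using F by (auto simp: subalgebra_def)
  have [measurable]: "D \<in> borel_measurable M" using D by (rule borel_measurable_integrable)
  have i: "integrable M (\<lambda>\<omega>. indicator A \<omega> * D \<omega>)"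
    using integrable_mult_indicator[OF A D] by simp
  have eq: "indicator A \<omega> * (D \<omega> - c) = indicator A \<omega> * D \<omega> - c * indicator A \<omega>" for \<omega>
    by (simp add: algebra_simps)
  have ic: "integrable M (\<lambda>\<omega>. c * indicator A \<omega>)" by (simp add: emeasure_eq_measure)
  have int: "integrable M (\<lambda>\<omega>. indicator A \<omega> * (D \<omega> - c))" unfolding eq using i ic by simp
  have nn: "0 \<le> indicator A \<omega> * (D \<omega> - c)" for \<omega> by (auto simp: A_def indicator_def)
  have "(\<integral>\<omega>. indicator A \<omega> * (D \<omega> - c) \<partial>M) \<le> 0"
    unfolding eq using i ic le[OF AF] by simp
  then have "(\<integral>\<omega>. indicator A \<omega> * (D \<omega> - c) \<partial>M) = 0"
    using integral_nonneg_AE[of "\<lambda>\<omega>. indicator A \<omega> * (D \<omega> - c)" M] nn by (simp add: antisym)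
  then have "AE \<omega> in M. indicator A \<omega> * (D \<omega> - c) = 0"
    using integral_nonneg_eq_0_iff_AE[OF int] nn by simp
  then show ?thesis
    using AE_space by eventually_elim (use F in \<open>auto simp: A_def indicator_def subalgebra_def split: if_splits\<close>)
qed

lemma countable_cells:
  assumes "\<delta> > (0::real)"
  obtains q :: "nat \<Rightarrow> 'a::euclidean_space" and l where
    "l \<in> borel \<rightarrow>\<^sub>M count_space UNIV" "\<And>y. dist (q (l y)) y < \<delta>"
proof -
  obtain q :: "nat \<Rightarrow> 'a" where q: "\<And>v e. e > 0 \<Longrightarrow> \<exists>i. dist (q i) v < e"
    by (rule dense_sequence) blast
  define l where "l y = (LEAST i. dist (q i) y < \<delta>)" for y
  show thesis
  proof (rule that)
    show "l \<in> borel \<rightarrow>\<^sub>M count_space UNIV" unfolding l_def by measurable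
    show "dist (q (l y)) y < \<delta>" for y unfolding l_def using q[OF assms] by (rule LeastI_ex)
  qed
qed

lemma bform_diff_left: "bform S (x - x') y = bform S x y - bform S x' y"
  by (simp add: bform_def inner_diff_left)

lemma bform_diff_right: "bform S x (y - y') = bform S x y - bform S x y'"
  by (simp add: bform_def matrix_vector_mult_diff_distrib inner_diff_right)

text \<open>Origin of the constant: replacing y by the centre of its cell costs \<delta> times the
  norm of x, once under \<gamma> and once under M. Replacing \<theta>(Y) by its conditional
  correction costs at most 2 \<delta> per coordinate times the norm of Y. The sum of the entries of
  S in absolute value bounds the form.\<close>

lemma Xset_approximates_MGamma:
  fixes Y :: "'a \<Rightarrow> real^'n" and S :: "real^'n^'n"
  assumes M: "prob_space M" and Y[measurable]: "Y \<in> borel_measurable M"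
    and Y2: "integrable M (\<lambda>\<omega>. (norm (Y \<omega>))\<^sup>2)"
    and atomless: "atomless (distr M borel Y)" and \<gamma>: "\<gamma> \<in> MGamma (distr M borel Y)"
    and \<delta>: "\<delta> > 0"
  shows "\<exists>X\<in>Xset M Y. (\<integral>p. bform S (fst p) (snd p) \<partial>\<gamma>) - (\<integral>\<omega>. bform S (X \<omega>) (Y \<omega>) \<partial>M)
    \<le> \<delta> * ((\<Sum>i\<in>UNIV. \<Sum>j\<in>UNIV. \<bar>S $ i $ j\<bar>) *
        (2 * real CARD('n) * (\<integral>\<omega>. norm (Y \<omega>) \<partial>M) + 2 * (\<integral>p. norm (fst p) \<partial>\<gamma>)))"
proof -
  interpret prob_space M by fact
  define K where "K = (\<Sum>i\<in>UNIV. \<Sum>j\<in>UNIV. \<bar>S $ i $ j\<bar>)"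
  have K: "K \<ge> 0" unfolding K_def by (intro sum_nonneg) auto
  define d where "d = real CARD('n)"
  have G: "prob_space \<gamma>" and sG[measurable_cong]: "sets \<gamma> = sets borel"
    and intG: "integrable \<gamma> (\<lambda>p. (norm (fst p))\<^sup>2)" "integrable \<gamma> (\<lambda>p. (norm (snd p))\<^sup>2)"
    and \<nu>: "distr \<gamma> borel snd = distr M borel Y"
    and mart: "\<And>i B. B \<in> sets borel \<Longrightarrow>
      (\<integral>p. indicator B (fst p) * snd p $ i \<partial>\<gamma>) = (\<integral>p. indicator B (fst p) * fst p $ i \<partial>\<gamma>)"
    using \<gamma> unfolding MGamma_iff by auto
  interpret G: prob_space \<gamma> by fact
  obtain q :: "nat \<Rightarrow> real^'n" and l where l[measurable]: "l \<in> borel \<rightarrow>\<^sub>M count_space UNIV"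
    and ql: "\<And>y. dist (q (l y)) y < \<delta>"
    using countable_cells[OF \<delta>] by metis
  obtain \<theta> :: "real^'n \<Rightarrow> real^'n" where \<theta>[measurable]: "\<theta> \<in> borel_measurable borel"
    and law: "distr (distr M borel Y) (borel \<Otimes>\<^sub>M count_space UNIV) (\<lambda>y. (\<theta> y, l y)) =
     distr \<gamma> (borel \<Otimes>\<^sub>M count_space UNIV) (\<lambda>p. (fst p, l (snd p)))"
    by (rule cellwise_transport[OF prob_space_distr[OF Y] _ G sG \<nu> _ l])
      (use atomless in \<open>auto simp: atomless_def\<close>)
  \<comment> \<open>A first candidate: it is Y-measurable and has the law of x, but satisfies the
    martingale property only approximately.\<close>
  define X0 where "X0 \<omega> = \<theta> (Y \<omega>)" for \<omega>
  define R where "R \<omega> = q (l (Y \<omega>))" for \<omega>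
  have [measurable]: "X0 \<in> borel_measurable M" "R \<in> borel_measurable M"
    unfolding X0_def[abs_def] R_def[abs_def] by measurable
  have law': "distr M (borel \<Otimes>\<^sub>M count_space UNIV) (\<lambda>\<omega>. (X0 \<omega>, l (Y \<omega>))) =
     distr \<gamma> (borel \<Otimes>\<^sub>M count_space UNIV) (\<lambda>p. (fst p, l (snd p)))"
    unfolding law[symmetric] by (subst distr_distr) (auto simp: comp_def X0_def)
  \<comment> \<open>Only functions of x and of the cell can be transferred between M and \<gamma>,
    so every comparison passes through the cell centres.\<close>
  have tr: "(\<integral>\<omega>. h (X0 \<omega>) (R \<omega>) \<partial>M) = (\<integral>p. h (fst p) (q (l (snd p))) \<partial>\<gamma>)"
    and tr_int: "integrable M (\<lambda>\<omega>. h (X0 \<omega>) (R \<omega>)) \<longleftrightarrow> integrable \<gamma> (\<lambda>p. h (fst p) (q (l (snd p))))"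
    if h[measurable]: "(\<lambda>z. h (fst z) (snd z)) \<in> borel_measurable (borel \<Otimes>\<^sub>M borel)"
    for h :: "real^'n \<Rightarrow> real^'n \<Rightarrow> real"
  proof -
    have "(\<lambda>z. (fst z, q (snd z))) \<in> borel \<Otimes>\<^sub>M count_space UNIV \<rightarrow>\<^sub>M (borel \<Otimes>\<^sub>M borel :: ((real^'n) \<times> (real^'n)) measure)"
      by measurable
    from measurable_compose[OF this h]
    have h'[measurable]: "(\<lambda>z. h (fst z) (q (snd z))) \<in> borel_measurable (borel \<Otimes>\<^sub>M count_space UNIV)" by simp
    have "(\<integral>\<omega>. h (X0 \<omega>) (R \<omega>) \<partial>M) = (\<integral>z. h (fst z) (q (snd z)) \<partial>distr M (borel \<Otimes>\<^sub>M count_space UNIV) (\<lambda>\<omega>. (X0 \<omega>, l (Y \<omega>))))"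
      by (subst integral_distr) (auto simp: R_def)
    also have "\<dots> = (\<integral>p. h (fst p) (q (l (snd p))) \<partial>\<gamma>)"
      unfolding law' by (subst integral_distr) auto
    finally show "(\<integral>\<omega>. h (X0 \<omega>) (R \<omega>) \<partial>M) = (\<integral>p. h (fst p) (q (l (snd p))) \<partial>\<gamma>)" .
    have "integrable M (\<lambda>\<omega>. h (X0 \<omega>) (R \<omega>)) \<longleftrightarrow>
        integrable (distr M (borel \<Otimes>\<^sub>M count_space UNIV) (\<lambda>\<omega>. (X0 \<omega>, l (Y \<omega>)))) (\<lambda>z. h (fst z) (q (snd z)))"
      by (subst integrable_distr_eq) (auto simp: R_def)
    also have "\<dots> \<longleftrightarrow> integrable \<gamma> (\<lambda>p. h (fst p) (q (l (snd p))))"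
      unfolding law' by (subst integrable_distr_eq) auto
    finally show "integrable M (\<lambda>\<omega>. h (X0 \<omega>) (R \<omega>)) \<longleftrightarrow> integrable \<gamma> (\<lambda>p. h (fst p) (q (l (snd p))))" .
  qed
  have X02: "integrable M (\<lambda>\<omega>. (norm (X0 \<omega>))\<^sup>2)"
    using tr_int[of "\<lambda>x _. (norm x)\<^sup>2"] intG by simp
  have close: "norm (y - q (l y)) \<le> \<delta>" for y using ql[of y] by (simp add: dist_norm norm_minus_commute)
  have closei: "\<bar>y $ i - q (l y) $ i\<bar> \<le> \<delta>" for y i
    using component_le_norm_cart[of "y - q (l y)" i] close[of y] by simp
  \<comment> \<open>Applied to the cell centres on both spaces and to X, each within a bounded
    distance of a square integrable variable.\<close>
  have L2_near: "integrable N (\<lambda>\<omega>. (norm (U \<omega>))\<^sup>2)"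
    if [measurable]: "U \<in> borel_measurable N" and W: "integrable N (\<lambda>\<omega>. (norm (W \<omega>))\<^sup>2)"
      and N: "prob_space N" and b: "AE \<omega> in N. norm (U \<omega> - W \<omega>) \<le> b"
    for N :: "'c measure" and U W :: "'c \<Rightarrow> real^'n" and b
  proof (rule Bochner_Integration.integrable_bound)
    interpret N: prob_space N by fact
    show "integrable N (\<lambda>\<omega>. 2 * (norm (W \<omega>))\<^sup>2 + 2 * b\<^sup>2)" using W by simp
    show "AE \<omega> in N. norm ((norm (U \<omega>))\<^sup>2) \<le> norm (2 * (norm (W \<omega>))\<^sup>2 + 2 * b\<^sup>2)"
      using b
    proof eventually_elim
      case (elim \<omega>)
      have "norm (U \<omega>) \<le> norm (W \<omega>) + b" using elim norm_triangle_sub[of "U \<omega>" "W \<omega>"] by linarith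
      then have "(norm (U \<omega>))\<^sup>2 \<le> (norm (W \<omega>) + b)\<^sup>2" by (rule power_mono) simp
      also have "\<dots> \<le> 2 * (norm (W \<omega>))\<^sup>2 + 2 * b\<^sup>2"
        using zero_le_power2[of "norm (W \<omega>) - b"] by (simp add: power2_sum power2_diff)
      finally show ?case by simp
    qed
  qed simp
  have R2: "integrable M (\<lambda>\<omega>. (norm (R \<omega>))\<^sup>2)"
  proof (rule L2_near[OF _ Y2 M])
    show "AE \<omega> in M. norm (R \<omega> - Y \<omega>) \<le> \<delta>" using close by (simp add: R_def norm_minus_commute)
  qed simp
  have q2: "integrable \<gamma> (\<lambda>p. (norm (q (l (snd p))))\<^sup>2)"
  proof (rule L2_near[OF _ intG(2) G])
    show "AE p in \<gamma>. norm (q (l (snd p)) - snd p) \<le> \<delta>" using close by (simp add: norm_minus_commute)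
  qed simp
  have iYi: "integrable M (\<lambda>\<omega>. Y \<omega> $ i)" and iX0i: "integrable M (\<lambda>\<omega>. X0 \<omega> $ i)"
    and iRi: "integrable M (\<lambda>\<omega>. R \<omega> $ i)" for i
    using Y2 X02 R2 by (auto intro!: integrable_component)
  have isi: "integrable \<gamma> (\<lambda>p. snd p $ i)" and iqi: "integrable \<gamma> (\<lambda>p. q (l (snd p)) $ i)" for i
    using intG q2 by (auto intro!: G.integrable_component)
  define F where "F = vimage_algebra (space M) X0 borel"
  interpret F: finite_measure_subalgebra M F
    unfolding F_def by (rule finite_measure_subalgebra_vimage_algebra[OF M]) simp
  have X0F[measurable]: "X0 \<in> borel_measurable F"
    unfolding F_def by (rule measurable_vimage_algebra1) simp
  define C where "C i = real_cond_exp M F (\<lambda>\<omega>. Y \<omega> $ i)" for i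
  have CF[measurable]: "C i \<in> borel_measurable F" for i unfolding C_def by simp
  have iC: "integrable M (C i)" for i unfolding C_def using iYi by (rule F.real_cond_exp_int(1))
  define X where "X \<omega> = (\<chi> i. C i \<omega>)" for \<omega>
  have XF[measurable]: "X \<in> borel_measurable F"
    unfolding X_def by (rule borel_measurable_vec_lambda) simp
  have XM[measurable]: "X \<in> borel_measurable M" by (rule measurable_from_subalg[OF F.subalg XF])
  \<comment> \<open>The chain runs from Y to its cell centre, across to the cell centre under
    \<gamma>, from there to y, and by the martingale property to x, which is transferred back to
    \<open>X0\<close>. The two passages between point and centre cost \<delta> each.\<close>
  have bound: "\<bar>(\<integral>\<omega>. indicator B (X0 \<omega>) * Y \<omega> $ i \<partial>M) - (\<integral>\<omega>. indicator B (X0 \<omega>) * X0 \<omega> $ i \<partial>M)\<bar>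
      \<le> 2 * \<delta> * (\<integral>\<omega>. indicator B (X0 \<omega>) \<partial>M)" if [measurable]: "B \<in> sets borel" for B i
  proof -
    have err: "\<bar>(\<integral>\<omega>. indicator B (U \<omega>) * V \<omega> \<partial>N) - (\<integral>\<omega>. indicator B (U \<omega>) * W \<omega> \<partial>N)\<bar>
        \<le> \<delta> * (\<integral>\<omega>. indicator B (U \<omega>) \<partial>N)"
      if N: "prob_space N" and [measurable]: "U \<in> borel_measurable N" and VW: "integrable N V" "integrable N W"
        and c: "\<And>\<omega>. \<bar>V \<omega> - W \<omega>\<bar> \<le> \<delta>" for N :: "'c measure" and U :: "'c \<Rightarrow> real^'n" and V W :: "'c \<Rightarrow> real"
    proof -
      interpret N: prob_space N by fact
      have i: "integrable N (\<lambda>\<omega>. indicator B (U \<omega>) * H \<omega>)" if H: "integrable N H" for H :: "'c \<Rightarrow> real"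
      proof (rule Bochner_Integration.integrable_bound[OF H])
        have [measurable]: "H \<in> borel_measurable N" using H by (rule borel_measurable_integrable)
        show "(\<lambda>\<omega>. indicator B (U \<omega>) * H \<omega>) \<in> borel_measurable N" by measurable
      qed (auto simp: indicator_def)
      have i1: "integrable N (\<lambda>\<omega>. indicator B (U \<omega>) * (1::real))" by (rule i) simp
      have "\<bar>(\<integral>\<omega>. indicator B (U \<omega>) * V \<omega> \<partial>N) - (\<integral>\<omega>. indicator B (U \<omega>) * W \<omega> \<partial>N)\<bar>
          = \<bar>\<integral>\<omega>. indicator B (U \<omega>) * V \<omega> - indicator B (U \<omega>) * W \<omega> \<partial>N\<bar>" using i VW by simp
      also have "\<dots> \<le> (\<integral>\<omega>. \<bar>indicator B (U \<omega>) * V \<omega> - indicator B (U \<omega>) * W \<omega>\<bar> \<partial>N)"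
        by (rule integral_abs_bound)
      also have "\<dots> \<le> (\<integral>\<omega>. \<delta> * indicator B (U \<omega>) \<partial>N)"
        by (rule integral_mono) (use i VW i1 c \<delta> in \<open>auto simp: indicator_def\<close>)
      finally show ?thesis by simp
    qed
    have 1: "\<bar>(\<integral>\<omega>. indicator B (X0 \<omega>) * Y \<omega> $ i \<partial>M) - (\<integral>\<omega>. indicator B (X0 \<omega>) * R \<omega> $ i \<partial>M)\<bar>
        \<le> \<delta> * (\<integral>\<omega>. indicator B (X0 \<omega>) \<partial>M)"
      by (rule err[OF M _ iYi iRi]) (use closei in \<open>auto simp: R_def\<close>)
    have 2: "\<bar>(\<integral>p. indicator B (fst p) * snd p $ i \<partial>\<gamma>) - (\<integral>p. indicator B (fst p) * q (l (snd p)) $ i \<partial>\<gamma>)\<bar>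
        \<le> \<delta> * (\<integral>p. indicator B (fst p) \<partial>\<gamma>)"
      by (rule err[OF G _ isi iqi]) (use closei in auto)
    have 3: "(\<integral>\<omega>. indicator B (X0 \<omega>) * R \<omega> $ i \<partial>M) = (\<integral>p. indicator B (fst p) * q (l (snd p)) $ i \<partial>\<gamma>)"
      by (rule tr[of "\<lambda>x y. indicator B x * y $ i"]) measurable
    have 4: "(\<integral>\<omega>. indicator B (X0 \<omega>) * X0 \<omega> $ i \<partial>M) = (\<integral>p. indicator B (fst p) * fst p $ i \<partial>\<gamma>)"
      by (rule tr[of "\<lambda>x y. indicator B x * x $ i"]) measurable
    have 5: "(\<integral>\<omega>. indicator B (X0 \<omega>) \<partial>M) = (\<integral>p. indicator B (fst p) \<partial>\<gamma> :: real)"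
      by (rule tr[of "\<lambda>x y. indicator B x"]) measurable
    show ?thesis using 1 2 3 4 5 mart[of B i] by simp
  qed
  have near: "AE \<omega> in M. \<bar>C i \<omega> - X0 \<omega> $ i\<bar> \<le> 2 * \<delta>" for i
  proof -
    have *: "\<bar>\<integral>\<omega>. indicator A \<omega> * (C i \<omega> - X0 \<omega> $ i) \<partial>M\<bar> \<le> 2 * \<delta> * measure M A" if A: "A \<in> sets F" for A
    proof -
      obtain B where B[measurable]: "B \<in> sets borel" and AB: "A = X0 -` B \<inter> space M"
        using A unfolding F_def by (auto simp: sets_vimage_algebra2)
      have [measurable]: "A \<in> sets M" using A F.subalg by (auto simp: subalgebra_def)
      have ind: "(\<integral>\<omega>. indicator A \<omega> * H \<omega> \<partial>M) = (\<integral>\<omega>. indicator B (X0 \<omega>) * H \<omega> \<partial>M)" for H :: "'a \<Rightarrow> real"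
        by (rule Bochner_Integration.integral_cong) (auto simp: AB indicator_def)
      have i: "integrable M (\<lambda>\<omega>. indicator A \<omega> * H \<omega>)" if "integrable M H" for H :: "'a \<Rightarrow> real"
        using integrable_mult_indicator[OF _ that, of A] by simp
      have "(\<integral>\<omega>. indicator A \<omega> * C i \<omega> \<partial>M) = (\<integral>\<omega>. indicator A \<omega> * Y \<omega> $ i \<partial>M)"
        unfolding C_def by (rule F.real_cond_exp_intg(2)[OF i[OF iYi]]) (use A in measurable)
      moreover have "(\<integral>\<omega>. indicator A \<omega> * (C i \<omega> - X0 \<omega> $ i) \<partial>M)
          = (\<integral>\<omega>. indicator A \<omega> * C i \<omega> \<partial>M) - (\<integral>\<omega>. indicator A \<omega> * X0 \<omega> $ i \<partial>M)"
        using i[OF iC] i[OF iX0i] by (simp add: right_diff_distrib)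
      moreover have "(\<integral>\<omega>. indicator B (X0 \<omega>) \<partial>M) = measure M A" using ind[of "\<lambda>_. 1"] by simp
      ultimately show ?thesis using bound[OF B, of i] by (simp add: ind)
    qed
    have iD: "integrable M (\<lambda>\<omega>. C i \<omega> - X0 \<omega> $ i)" using iC iX0i by simp
    have "AE \<omega> in M. C i \<omega> - X0 \<omega> $ i \<le> 2 * \<delta>"
      by (rule AE_le_of_set_integral_le[OF F.subalg _ iD]) (use * in \<open>auto intro: abs_le_D1\<close>)
    moreover have "AE \<omega> in M. - (C i \<omega> - X0 \<omega> $ i) \<le> 2 * \<delta>"
    proof (rule AE_le_of_set_integral_le[OF F.subalg])
      show "integrable M (\<lambda>\<omega>. - (C i \<omega> - X0 \<omega> $ i))" using iD by (rule Bochner_Integration.integrable_minus)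
      fix A assume "A \<in> sets F"
      from *[OF this] show "(\<integral>\<omega>. indicator A \<omega> * - (C i \<omega> - X0 \<omega> $ i) \<partial>M) \<le> 2 * \<delta> * measure M A"
        unfolding mult_minus_right by simp
    qed measurable
    ultimately show ?thesis by eventually_elim auto
  qed
  have XX0: "AE \<omega> in M. norm (X \<omega> - X0 \<omega>) \<le> d * (2 * \<delta>)"
  proof -
    have "AE \<omega> in M. \<forall>i. \<bar>C i \<omega> - X0 \<omega> $ i\<bar> \<le> 2 * \<delta>"
      using near by (simp add: AE_all_countable)
    then show ?thesis
    proof eventually_elim
      case (elim \<omega>)
      have "norm (X \<omega> - X0 \<omega>) \<le> (\<Sum>i\<in>UNIV. \<bar>(X \<omega> - X0 \<omega>) $ i\<bar>)" by (rule norm_le_l1_cart)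
      also have "\<dots> \<le> (\<Sum>i\<in>(UNIV::'n set). 2 * \<delta>)" using elim by (intro sum_mono) (simp add: X_def)
      finally show ?case by (simp add: d_def)
    qed
  qed
  have X2: "integrable M (\<lambda>\<omega>. (norm (X \<omega>))\<^sup>2)" by (rule L2_near[OF XM X02 M XX0])
  have "X \<in> Xset M Y"
    unfolding Xset_def L2rv_def
  proof (intro CollectI conjI allI)
    let ?G = "vimage_algebra (space M) Y borel"
    \<comment> \<open>As \<open>X0\<close> is a function of Y, its sigma-algebra is coarser than
      that of Y, and X inherits Y-measurability.\<close>
    have "X0 \<in> borel_measurable ?G"
      unfolding X0_def by (rule measurable_compose[OF measurable_vimage_algebra1 \<theta>]) simp
    then have "sets F \<subseteq> sets ?G"
      unfolding F_def using measurable_sets[of X0 ?G borel] by (auto simp: sets_vimage_algebra2)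
    moreover have "space F = space ?G" by (simp add: F_def)
    ultimately have "subalgebra ?G F" by (simp add: subalgebra_def)
    then show "X \<in> borel_measurable ?G" using XF by (rule measurable_from_subalg)
    show "AE \<omega> in M. real_cond_exp M (vimage_algebra (space M) X borel) (\<lambda>\<omega>. Y \<omega> $ i) \<omega> = X \<omega> $ i" for i
      unfolding martingale_iff[OF M XM Y X2 Y2]
    proof
      fix B :: "(real^'n) set" assume [measurable]: "B \<in> sets borel"
      \<comment> \<open>The tower property: X conditions on \<open>X0\<close>, whereas
        \<open>Xset\<close> asks for conditioning on X itself. Since X is F-measurable, the events X
        \<in> B are admissible test sets for the former.\<close>
      have i: "integrable M (\<lambda>\<omega>. indicator B (X \<omega>) * Y \<omega> $ i)"
        by (rule Bochner_Integration.integrable_bound[OF iYi[of i]]) (auto simp: indicator_def)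
      have "(\<integral>\<omega>. indicator B (X \<omega>) * C i \<omega> \<partial>M) = (\<integral>\<omega>. indicator B (X \<omega>) * Y \<omega> $ i \<partial>M)"
        unfolding C_def by (rule F.real_cond_exp_intg(2)[OF i]) measurable
      then show "(\<integral>\<omega>. indicator B (X \<omega>) * Y \<omega> $ i \<partial>M) = (\<integral>\<omega>. indicator B (X \<omega>) * X \<omega> $ i \<partial>M)"
        by (simp add: X_def)
    qed
  qed (use X2 in auto)
  moreover have "(\<integral>p. bform S (fst p) (snd p) \<partial>\<gamma>) - (\<integral>\<omega>. bform S (X \<omega>) (Y \<omega>) \<partial>M)
    \<le> \<delta> * (K * (2 * d * (\<integral>\<omega>. norm (Y \<omega>) \<partial>M) + 2 * (\<integral>p. norm (fst p) \<partial>\<gamma>)))"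
  proof -
    have nY: "integrable M (\<lambda>\<omega>. norm (Y \<omega>))" and nX0: "integrable M (\<lambda>\<omega>. norm (X0 \<omega>))"
      using Y2 X02 by (auto intro!: integrable_norm integrable_of_square_integrable)
    have nx: "integrable \<gamma> (\<lambda>p. norm (fst p))"
      using intG by (auto intro!: integrable_norm G.integrable_of_square_integrable)
    have i1: "integrable M (\<lambda>\<omega>. bform S (X \<omega>) (Y \<omega>))" and i2: "integrable M (\<lambda>\<omega>. bform S (X0 \<omega>) (R \<omega>))"
      using X2 Y2 X02 R2 by (auto intro!: integrable_bform)
    have i3: "integrable \<gamma> (\<lambda>p. bform S (fst p) (snd p))"
      and i4: "integrable \<gamma> (\<lambda>p. bform S (fst p) (q (l (snd p))))"
      using intG q2 by (auto intro!: integrable_bform)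
    have "(\<integral>p. bform S (fst p) (snd p) \<partial>\<gamma>) - (\<integral>p. bform S (fst p) (q (l (snd p))) \<partial>\<gamma>)
        = (\<integral>p. bform S (fst p) (snd p) - bform S (fst p) (q (l (snd p))) \<partial>\<gamma>)"
      using i3 i4 by simp
    also have "\<dots> \<le> (\<integral>p. K * (norm (fst p) * \<delta>) \<partial>\<gamma>)"
    proof (rule integral_mono)
      fix p
      have "bform S (fst p) (snd p) - bform S (fst p) (q (l (snd p))) = bform S (fst p) (snd p - q (l (snd p)))"
        by (simp add: bform_diff_right)
      also have "\<dots> \<le> K * (norm (fst p) * norm (snd p - q (l (snd p))))"
        using abs_bform_le[of S "fst p" "snd p - q (l (snd p))"] unfolding K_def[symmetric] by linarith
      also have "\<dots> \<le> K * (norm (fst p) * \<delta>)" using K close by (intro mult_left_mono) auto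
      finally show "bform S (fst p) (snd p) - bform S (fst p) (q (l (snd p))) \<le> K * (norm (fst p) * \<delta>)" .
    qed (use i3 i4 nx in auto)
    finally have A: "(\<integral>p. bform S (fst p) (snd p) \<partial>\<gamma>) - (\<integral>p. bform S (fst p) (q (l (snd p))) \<partial>\<gamma>)
        \<le> K * ((\<integral>p. norm (fst p) \<partial>\<gamma>) * \<delta>)" using nx by simp
    have B: "(\<integral>\<omega>. bform S (X0 \<omega>) (R \<omega>) \<partial>M) = (\<integral>p. bform S (fst p) (q (l (snd p))) \<partial>\<gamma>)"
      by (rule tr) measurable
    have C': "(\<integral>\<omega>. norm (X0 \<omega>) \<partial>M) = (\<integral>p. norm (fst p) \<partial>\<gamma>)"
      by (rule tr[of "\<lambda>x _. norm x"]) measurable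
    have "(\<integral>\<omega>. bform S (X0 \<omega>) (R \<omega>) \<partial>M) - (\<integral>\<omega>. bform S (X \<omega>) (Y \<omega>) \<partial>M)
        = (\<integral>\<omega>. bform S (X0 \<omega>) (R \<omega>) - bform S (X \<omega>) (Y \<omega>) \<partial>M)"
      using i1 i2 by simp
    also have "\<dots> \<le> (\<integral>\<omega>. K * (norm (X0 \<omega>) * \<delta>) + K * (d * (2 * \<delta>) * norm (Y \<omega>)) \<partial>M)"
    proof (rule integral_mono_AE)
      show "AE \<omega> in M. bform S (X0 \<omega>) (R \<omega>) - bform S (X \<omega>) (Y \<omega>)
          \<le> K * (norm (X0 \<omega>) * \<delta>) + K * (d * (2 * \<delta>) * norm (Y \<omega>))"
        using XX0
      proof eventually_elim
        case (elim \<omega>)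
        have "bform S (X0 \<omega>) (R \<omega>) - bform S (X \<omega>) (Y \<omega>)
            = bform S (X0 \<omega>) (R \<omega> - Y \<omega>) + bform S (X0 \<omega> - X \<omega>) (Y \<omega>)"
          by (simp add: bform_diff_left bform_diff_right)
        also have "\<dots> \<le> K * (norm (X0 \<omega>) * norm (R \<omega> - Y \<omega>)) + K * (norm (X0 \<omega> - X \<omega>) * norm (Y \<omega>))"
          using abs_bform_le[of S "X0 \<omega>" "R \<omega> - Y \<omega>"] abs_bform_le[of S "X0 \<omega> - X \<omega>" "Y \<omega>"]
          unfolding K_def[symmetric] by linarith
        also have "\<dots> \<le> K * (norm (X0 \<omega>) * \<delta>) + K * (d * (2 * \<delta>) * norm (Y \<omega>))"
          using K close[of "Y \<omega>"] elim
          by (intro add_mono mult_left_mono mult_right_mono) (auto simp: R_def norm_minus_commute)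
        finally show ?case .
      qed
    qed (use i1 i2 nX0 nY in auto)
    finally have D: "(\<integral>\<omega>. bform S (X0 \<omega>) (R \<omega>) \<partial>M) - (\<integral>\<omega>. bform S (X \<omega>) (Y \<omega>) \<partial>M)
        \<le> K * ((\<integral>p. norm (fst p) \<partial>\<gamma>) * \<delta>) + K * (d * (2 * \<delta>) * (\<integral>\<omega>. norm (Y \<omega>) \<partial>M))"
      using nX0 nY by (simp add: C')
    show ?thesis using A B D by (simp add: algebra_simps)
  qed
  ultimately show ?thesis unfolding K_def d_def by blast
qed

theorem theorem1:
  fixes M :: "'a measure" and Y :: "'a \<Rightarrow> real^'n" and S :: "real^'n^'n" and m :: nat
  assumes "prob_space M"
    and "S \<in> sym_inv_pos m"
    and "L2rv M Y"
    and "atomless (distr M borel Y)"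
  shows "\<exists>\<gamma>\<in>MGamma (distr M borel Y).
           (\<forall>\<gamma>'\<in>MGamma (distr M borel Y).
              (\<integral>p. bform S (fst p) (snd p) \<partial>\<gamma>') \<le> (\<integral>p. bform S (fst p) (snd p) \<partial>\<gamma>)) \<and>
           (SUP X\<in>Xset M Y. ereal (\<integral>\<omega>. bform S (X \<omega>) (Y \<omega>) \<partial>M))
             = ereal (\<integral>p. bform S (fst p) (snd p) \<partial>\<gamma>)"
proof -
  have Y[measurable]: "Y \<in> borel_measurable M" and Y2: "integrable M (\<lambda>\<omega>. (norm (Y \<omega>))\<^sup>2)"
    using assms(3) by (auto simp: L2rv_def)
  \<comment> \<open>The diagonal coupling shows that the maximum is taken over a nonempty
    set.\<close>
  have "distr M borel (\<lambda>\<omega>. (Y \<omega>, Y \<omega>)) \<in> MGamma (distr M borel Y)"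
    using distr_Pair_in_MGamma[OF assms(1) Y Y Y2 Y2] by simp
  then obtain \<gamma> where \<gamma>: "\<gamma> \<in> MGamma (distr M borel Y)"
    and max: "\<And>\<gamma>'. \<gamma>' \<in> MGamma (distr M borel Y) \<Longrightarrow>
      (\<integral>p. bform S (fst p) (snd p) \<partial>\<gamma>') \<le> (\<integral>p. bform S (fst p) (snd p) \<partial>\<gamma>)"
    using MGamma_attains_max[of "distr M borel Y" S] by blast
  have "(SUP X\<in>Xset M Y. ereal (\<integral>\<omega>. bform S (X \<omega>) (Y \<omega>) \<partial>M)) = ereal (\<integral>p. bform S (fst p) (snd p) \<partial>\<gamma>)"
  proof (rule antisym)
    show "(SUP X\<in>Xset M Y. ereal (\<integral>\<omega>. bform S (X \<omega>) (Y \<omega>) \<partial>M)) \<le> ereal (\<integral>p. bform S (fst p) (snd p) \<partial>\<gamma>)"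
    proof (rule SUP_least)
      fix X assume "X \<in> Xset M Y"
      then have X[measurable]: "X \<in> borel_measurable M" and X2: "integrable M (\<lambda>\<omega>. (norm (X \<omega>))\<^sup>2)"
        and ce: "\<And>i. AE \<omega> in M. real_cond_exp M (vimage_algebra (space M) X borel) (\<lambda>\<omega>. Y \<omega> $ i) \<omega> = X \<omega> $ i"
        by (auto simp: Xset_def L2rv_def)
      have "distr M borel (\<lambda>\<omega>. (X \<omega>, Y \<omega>)) \<in> MGamma (distr M borel Y)"
        using ce unfolding martingale_iff[OF assms(1) X Y X2 Y2]
        by (intro distr_Pair_in_MGamma[OF assms(1) X Y X2 Y2]) blast
      from max[OF this] show "ereal (\<integral>\<omega>. bform S (X \<omega>) (Y \<omega>) \<partial>M) \<le> ereal (\<integral>p. bform S (fst p) (snd p) \<partial>\<gamma>)"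
        by (simp add: integral_distr)
    qed
    define c where "c = (\<Sum>i\<in>UNIV. \<Sum>j\<in>UNIV. \<bar>S $ i $ j\<bar>) *
        (2 * real CARD('n) * (\<integral>\<omega>. norm (Y \<omega>) \<partial>M) + 2 * (\<integral>p. norm (fst p) \<partial>\<gamma>))"
    have "c \<ge> 0" unfolding c_def by (intro mult_nonneg_nonneg add_nonneg_nonneg sum_nonneg) auto
    show "ereal (\<integral>p. bform S (fst p) (snd p) \<partial>\<gamma>) \<le> (SUP X\<in>Xset M Y. ereal (\<integral>\<omega>. bform S (X \<omega>) (Y \<omega>) \<partial>M))"
    proof (rule ereal_le_epsilon2)
      fix e :: real assume e: "0 < e"
      \<comment> \<open>The constant c depends on \<gamma>, S and Y but not on the mesh, so the mesh
        can be chosen last; adding 1 covers the case c = 0.\<close>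
      define \<delta> where "\<delta> = e / (c + 1)"
      have \<delta>: "\<delta> > 0" "\<delta> * c \<le> e" using e \<open>c \<ge> 0\<close> by (auto simp: \<delta>_def field_simps)
      from Xset_approximates_MGamma[OF assms(1) Y Y2 assms(4) \<gamma> \<delta>(1), of S] obtain X
        where X: "X \<in> Xset M Y"
          and le: "(\<integral>p. bform S (fst p) (snd p) \<partial>\<gamma>) - (\<integral>\<omega>. bform S (X \<omega>) (Y \<omega>) \<partial>M) \<le> \<delta> * c"
        unfolding c_def by blast
      have "ereal (\<integral>p. bform S (fst p) (snd p) \<partial>\<gamma>) \<le> ereal (\<integral>\<omega>. bform S (X \<omega>) (Y \<omega>) \<partial>M) + ereal e"
        using le \<delta>(2) by simp
      also have "\<dots> \<le> (SUP X\<in>Xset M Y. ereal (\<integral>\<omega>. bform S (X \<omega>) (Y \<omega>) \<partial>M)) + ereal e"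
        by (intro add_right_mono SUP_upper X)
      finally show "ereal (\<integral>p. bform S (fst p) (snd p) \<partial>\<gamma>)
          \<le> (SUP X\<in>Xset M Y. ereal (\<integral>\<omega>. bform S (X \<omega>) (Y \<omega>) \<partial>M)) + ereal e" .
    qed
  qed
  with \<gamma> max show ?thesis by blast
qed

end
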